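(* Let $K$ be a field and let $I$ be a squarefree monomial ideal of $S=K[x_1,\dots,x_n]$ with minimal set of monomial generators $G(I)=\{u_1,\dots,u_p\}$, $p\ge 1$. Let $s$ be the support index of $I$. Then (a) $\operatorname{pd}(I)\le \min\{s,n\}=\min\{\operatorname{b-cosize}_S(I)-1,\,n\}$; (b) $\operatorname{reg}(I)\le \operatorname{cosize}(I)+1$.
   Context: $S$ is standard graded. For a nonzero graded ideal $I$ with graded Betti numbers $\beta_{i,j}(I)$ (so the $i$-th module, $i\ge 0$, of the minimal graded free $S$-resolution of $I$ is $\bigoplus_j S(-j)^{\beta_{i,j}(I)}$), $\operatorname{pd}(I)=\max\{i:\beta_{i,j}(I)\ne0\text{ for some }j\}$ and $\operatorname{reg}(I)=\max\{j-i:\beta_{i,j}(I)\neq 0\}$. A squarefree ideal is an ideal generated by squarefree monomials. For a monomial $u$, $\operatorname{supp}(u)=\{i: x_i \text{ divides } u\}$. For $0\le i\le p-1$ put $\mathcal{A}_i=\big\{\bigcup_{\ell=1}^{i+1}\operatorname{supp}(u_{j_\ell}) : 1\le j_1<j_2<\cdots<j_{i+1}\le p\big\}$. The support index of $I$ is $s=\min\{i : A=\bigcup_{\ell=1}^p\operatorname{supp}(u_\ell)\text{ for all }A\in\mathcal{A}_i\}$. $\operatorname{b-cosize}_S(I)$ is the smallest integer $\ell\ge1$ such that for all $1\le j_1<\cdots<j_\ell\le p$ one has $\operatorname{lcm}(u_{j_1},\dots,u_{j_\ell})=\operatorname{lcm}(u_1,\dots,u_p)$. Let $w$ be the smallest integer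 $\ell\ge1$ such that there exist $1\le j_1<\cdots<j_\ell\le p$ with $\operatorname{lcm}(u_{j_1},\dots,u_{j_\ell})=\operatorname{lcm}(u_1,\dots,u_p)$. Then $\operatorname{cosize}(I)=\deg\operatorname{lcm}(u_1,\dots,u_p)-w$. *)

theory Defs
  imports Complex_Main "HOL-Library.Poly_Mapping" "HOL-Library.Cardinality"
begin

text \<open>
  The variables of \<open>S = K[x\<^sub>1, \<dots>, x\<^sub>n]\<close> are the elements of a finite type \<open>'x\<close>, so \<open>n = CARD('x)\<close>.
  A monomial is its exponent vector; products of monomials are sums of exponent vectors.
\<close>

type_synonym 'x mon = "'x \<Rightarrow>\<^sub>0 nat"
type_synonym ('x, 'k) mpoly = "'x mon \<Rightarrow>\<^sub>0 'k"

abbreviation monom_poly :: "'x mon \<Rightarrow> ('x, 'k::comm_ring_1) mpoly" where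
  "monom_poly m \<equiv> Poly_Mapping.single m 1"

definition mon_deg :: "'x::finite mon \<Rightarrow> nat" where
  "mon_deg m = (\<Sum>x\<in>UNIV. Poly_Mapping.lookup m x)"

abbreviation supp :: "'x mon \<Rightarrow> 'x set" where
  "supp m \<equiv> Poly_Mapping.keys m"

definition squarefree_mon :: "'x mon \<Rightarrow> bool" where
  "squarefree_mon m \<longleftrightarrow> (\<forall>x. Poly_Mapping.lookup m x \<le> 1)"

lift_definition mon_lcm :: "'x::finite mon set \<Rightarrow> 'x mon"
  is "\<lambda>U x. Max (insert 0 ((\<lambda>m. m x) ` U))"
  by simp


section \<open>Monomial ideals\<close>

definition ideal_gen :: "'a::comm_ring_1 set \<Rightarrow> 'a set" where
  "ideal_gen A = module.span (*) A"

definition squarefree_monomial_ideal :: "('x, 'k::field) mpoly set \<Rightarrow> bool" where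
  "squarefree_monomial_ideal I \<longleftrightarrow>
     (\<exists>U. (\<forall>m\<in>U. squarefree_mon m) \<and> I = ideal_gen (monom_poly ` U))"

definition minimal_monomial_generators :: "'x mon set \<Rightarrow> ('x, 'k::field) mpoly set \<Rightarrow> bool" where
  "minimal_monomial_generators G I \<longleftrightarrow>
     ideal_gen (monom_poly ` G) = I \<and> (\<forall>G'. G' \<subset> G \<longrightarrow> ideal_gen (monom_poly ` G') \<noteq> I)"


section \<open>Minimal graded free resolutions and Betti numbers\<close>

definition homogeneous :: "('x::finite, 'k::field) mpoly \<Rightarrow> int \<Rightarrow> bool" where
  "homogeneous f d \<longleftrightarrow> (\<forall>m\<in>Poly_Mapping.keys f. int (mon_deg m) = d)"

text \<open>The ideal \<open>(x\<^sub>1, \<dots>, x\<^sub>n)\<close>, that is, the polynomials without constant term.\<close>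

definition irrelevant_ideal :: "('x::finite, 'k::field) mpoly set" where
  "irrelevant_ideal = ideal_gen (range (\<lambda>x. monom_poly (Poly_Mapping.single x 1)))"

text \<open>
  A sequence of maps \<open>\<cdots> \<rightarrow> F\<^sub>2 \<rightarrow> F\<^sub>1 \<rightarrow> F\<^sub>0 \<rightarrow> I\<close> given by matrices. If
  \<open>shifts F i = [j\<^sub>0, \<dots>, j\<^sub>r\<^sub>-\<^sub>1]\<close>, then \<open>F\<^sub>i\<close> is \<open>S(-j\<^sub>0) \<oplus> \<dots> \<oplus> S(-j\<^sub>r\<^sub>-\<^sub>1)\<close>, whose \<open>k\<close>-th basis
  element has degree \<open>j\<^sub>k\<close>. The \<open>k\<close>-th basis element of \<open>F\<^sub>0\<close> is sent to \<open>aug F k\<close>, and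
  \<open>diff F i k l\<close> is the \<open>l\<close>-th coordinate in \<open>F\<^sub>i\<close> of the image of the \<open>k\<close>-th basis element
  of \<open>F\<^sub>i\<^sub>+\<^sub>1\<close>. Entries outside of the index range are irrelevant.
\<close>

record (overloaded) ('x, 'k) free_complex =
  shifts :: "nat \<Rightarrow> int list"
  aug :: "nat \<Rightarrow> ('x, 'k) mpoly"
  diff :: "nat \<Rightarrow> nat \<Rightarrow> nat \<Rightarrow> ('x, 'k) mpoly"

definition rank :: "('x, 'k::field) free_complex \<Rightarrow> nat \<Rightarrow> nat" where
  "rank F i = length (shifts F i)"

definition free_mod :: "('x, 'k::field) free_complex \<Rightarrow> nat \<Rightarrow> (nat \<Rightarrow> ('x, 'k) mpoly) set" where
  "free_mod F i = {v. \<forall>k\<ge>rank F i. v k = 0}"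

definition aug_map :: "('x, 'k::field) free_complex \<Rightarrow> (nat \<Rightarrow> ('x, 'k) mpoly) \<Rightarrow> ('x, 'k) mpoly" where
  "aug_map F v = (\<Sum>k<rank F 0. v k * aug F k)"

definition diff_map ::
  "('x, 'k::field) free_complex \<Rightarrow> nat \<Rightarrow> (nat \<Rightarrow> ('x, 'k) mpoly) \<Rightarrow> nat \<Rightarrow> ('x, 'k) mpoly" where
  "diff_map F i v = (\<lambda>l. if l < rank F i then \<Sum>k<rank F (Suc i). v k * diff F i k l else 0)"

definition graded_free_resolution ::
  "('x::finite, 'k::field) mpoly set \<Rightarrow> ('x, 'k) free_complex \<Rightarrow> bool" where
  "graded_free_resolution I F \<longleftrightarrow>
     (\<forall>k<rank F 0. homogeneous (aug F k) (shifts F 0 ! k)) \<and>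
     (\<forall>i. \<forall>k<rank F (Suc i). \<forall>l<rank F i.
        homogeneous (diff F i k l) (shifts F (Suc i) ! k - shifts F i ! l)) \<and>
     aug_map F ` free_mod F 0 = I \<and>
     diff_map F 0 ` free_mod F 1 = {v \<in> free_mod F 0. aug_map F v = 0} \<and>
     (\<forall>i. diff_map F (Suc i) ` free_mod F (Suc (Suc i)) =
        {v \<in> free_mod F (Suc i). diff_map F i v = (\<lambda>_. 0)})"

text \<open>Minimality: the image of \<open>F\<^sub>i\<^sub>+\<^sub>1\<close> in \<open>F\<^sub>i\<close> lies in \<open>(x\<^sub>1, \<dots>, x\<^sub>n) F\<^sub>i\<close>.\<close>

definition minimal_graded_free_resolution ::
  "('x::finite, 'k::field) mpoly set \<Rightarrow> ('x, 'k) free_complex \<Rightarrow> bool" where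
  "minimal_graded_free_resolution I F \<longleftrightarrow>
     graded_free_resolution I F \<and>
     (\<forall>i. \<forall>k<rank F (Suc i). \<forall>l<rank F i. diff F i k l \<in> irrelevant_ideal)"

text \<open>
  Every graded ideal has a minimal graded free resolution, unique up to isomorphism of graded
  complexes, so the number below does not depend on the resolution that is chosen.
\<close>

definition graded_betti :: "('x::finite, 'k::field) mpoly set \<Rightarrow> nat \<Rightarrow> int \<Rightarrow> nat" where
  "graded_betti I i j = count_list (shifts (SOME F. minimal_graded_free_resolution I F) i) j"

definition pd :: "('x::finite, 'k::field) mpoly set \<Rightarrow> nat" where
  "pd I = Max {i. \<exists>j. graded_betti I i j \<noteq> 0}"

definition reg :: "('x::finite, 'k::field) mpoly set \<Rightarrow> int" where
  "reg I = Max {j - int i | i j. graded_betti I i j \<noteq> 0}"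


section \<open>Support index and cosizes\<close>

text \<open>
  The generators are \<open>u 1, \<dots>, u p\<close>. An index sequence \<open>1 \<le> j\<^sub>1 < \<dots> < j\<^sub>l \<le> p\<close> is represented by
  the \<open>l\<close>-element subset \<open>{j\<^sub>1, \<dots>, j\<^sub>l}\<close> of \<open>{1..p}\<close>.
\<close>

definition supp_unions :: "(nat \<Rightarrow> 'x mon) \<Rightarrow> nat \<Rightarrow> nat \<Rightarrow> 'x set set" where
  "supp_unions u p i = {(\<Union>j\<in>J. supp (u j)) | J. J \<subseteq> {1..p} \<and> card J = i + 1}"

definition support_index :: "(nat \<Rightarrow> 'x mon) \<Rightarrow> nat \<Rightarrow> nat" where
  "support_index u p =
     (LEAST i. i < p \<and> (\<forall>A\<in>supp_unions u p i. A = (\<Union>j\<in>{1..p}. supp (u j))))"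

definition b_cosize :: "(nat \<Rightarrow> 'x::finite mon) \<Rightarrow> nat \<Rightarrow> nat" where
  "b_cosize u p =
     (LEAST l. 1 \<le> l \<and>
        (\<forall>J. J \<subseteq> {1..p} \<and> card J = l \<longrightarrow> mon_lcm (u ` J) = mon_lcm (u ` {1..p})))"

definition min_cover_number :: "(nat \<Rightarrow> 'x::finite mon) \<Rightarrow> nat \<Rightarrow> nat" where
  "min_cover_number u p =
     (LEAST l. 1 \<le> l \<and>
        (\<exists>J. J \<subseteq> {1..p} \<and> card J = l \<and> mon_lcm (u ` J) = mon_lcm (u ` {1..p})))"

text \<open>Integer-valued: the unit ideal has cosize \<open>-1\<close>.\<close>

definition cosize :: "(nat \<Rightarrow> 'x::finite mon) \<Rightarrow> nat \<Rightarrow> int" where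
  "cosize u p = int (mon_deg (mon_lcm (u ` {1..p}))) - int (min_cover_number u p)"

end

theory Submission
  imports Defs "HOL-Library.Function_Algebras"
begin

text \<open>
  Both bounds are read off from one explicit resolution. A simplicial complex on \<open>{1, \<dots>, p}\<close>,
  with each face \<open>J\<close> placed in the degree of \<open>lcm (u\<^sub>j | j \<in> J)\<close>, gives a subcomplex of the
  Taylor complex, and this is a resolution of \<open>I\<close> as soon as for every monomial \<open>m\<close> in
  \<open>I\<close> the faces whose lcm divides \<open>m\<close> form a cone (\<open>supported_resolution_exists\<close>). The full simplex has
  this property. So has the smaller complex \<open>\<Delta>\<close> of the faces with at most \<open>s\<close> vertices,
  together with the faces with \<open>s + 1\<close> vertices that contain the vertex \<open>1\<close>: if \<open>u\<^sub>1\<close> divides \<open>m\<close>, then \<open>1\<close>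
  is an apex; otherwise no \<open>s + 1\<close> generators divide \<open>m\<close>, because by the choice of \<open>s\<close> their lcm
  would be divisible by \<open>u\<^sub>1\<close>, and so the faces in question form a full simplex.

  The shifts of a minimal resolution \<open>F\<close> occur, in each homological degree, among those of any graded
  free resolution (\<open>minimal_shifts_subset\<close>): the comparison maps from \<open>F\<close> to the other resolution and
  back compose to a map that is homotopic to the identity, hence equal to it modulo
  \<open>(x\<^sub>1, \<dots>, x\<^sub>n)\<close>. So each shift \<open>j\<close> of \<open>F\<^sub>i\<close> is the degree of the lcm of some \<open>i + 1\<close> generators
  that form a face of \<open>\<Delta>\<close>, which has these consequences.

  \<^item> \<open>i \<le> s\<close>, as no face of \<open>\<Delta>\<close> has more than \<open>s + 1\<close> vertices.
  \<^item> \<open>i \<le> j \<le> n\<close>: shifts grow strictly along a minimal resolution (\<open>minimal_shift_ge\<close>), and the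
    lcm is squarefree.
  \<^item> \<open>j - i \<le> cosize I + 1\<close>: the \<open>i + 1\<close> generators can be completed to a cover of all variables that
    occur in \<open>G(I)\<close> by one further generator for each variable that is not yet covered, so
    \<open>w \<le> i + 1 + (deg lcm (u\<^sub>1, \<dots>, u\<^sub>p) - j)\<close> (\<open>min_cover_number_le\<close>).

  Since the Betti numbers are read off from some minimal resolution, one has to exist. It is
  built in multidegrees (\<open>minimal_resolution_exists\<close>): squarefree monomial ideals and all
  their syzygy modules are determined by their components in squarefree degrees, of which there are
  only finitely many, so that linear algebra over \<open>K\<close> suffices.
\<close>

section \<open>Monomials and homogeneous polynomials\<close>

definition mon_dvd :: "'x mon \<Rightarrow> 'x mon \<Rightarrow> bool"  (infix \<open>\<preceq>\<close> 50) where
  "s \<preceq> t \<longleftrightarrow> (\<forall>x. Poly_Mapping.lookup s x \<le> Poly_Mapping.lookup t x)"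

lemma mon_dvd_refl [simp]: "s \<preceq> s"
  by (simp add: mon_dvd_def)

lemma mon_dvd_trans: "s \<preceq> t \<Longrightarrow> t \<preceq> r \<Longrightarrow> s \<preceq> r"
  unfolding mon_dvd_def using le_trans by blast

lemma mon_dvd_antisym: "s \<preceq> t \<Longrightarrow> t \<preceq> s \<Longrightarrow> s = t"
  by (simp add: mon_dvd_def poly_mapping_eqI antisym)

lemma zero_mon_dvd [simp]: "0 \<preceq> t"
  by (simp add: mon_dvd_def)

lemma mon_dvd_add [simp]: "s \<preceq> s + r" "s \<preceq> r + s"
  by (simp_all add: mon_dvd_def lookup_add)

lemma mon_dvd_add_diff: "s \<preceq> t \<Longrightarrow> s + (t - s) = t"
  by (intro poly_mapping_eqI) (simp add: mon_dvd_def lookup_add lookup_minus)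

lemma mon_diff_add_diff: "r \<preceq> s \<Longrightarrow> s \<preceq> t \<Longrightarrow> (t - s) + (s - r) = t - r"
  by (intro poly_mapping_eqI) (simp add: mon_dvd_def lookup_add lookup_minus)

lemma mon_deg_zero [simp]: "mon_deg 0 = 0"
  by (simp add: mon_deg_def)

lemma mon_deg_add: "mon_deg (s + t) = mon_deg s + mon_deg t"
  by (simp add: mon_deg_def lookup_add sum.distrib)

lemma mon_deg_eq_0_iff: "mon_deg s = 0 \<longleftrightarrow> s = 0"
  by (auto simp: mon_deg_def intro!: poly_mapping_eqI)

lemma mon_deg_diff: "s \<preceq> t \<Longrightarrow> int (mon_deg (t - s)) = int (mon_deg t) - int (mon_deg s)"
  by (metis add_diff_cancel_left' mon_deg_add mon_dvd_add_diff of_nat_add)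

lemma poly_eq_sum_single:
  "f = (\<Sum>m\<in>Poly_Mapping.keys f. Poly_Mapping.single m (Poly_Mapping.lookup f m))"
  by (intro poly_mapping_eqI)
    (simp add: lookup_sum lookup_single when_def not_in_keys_iff_lookup_eq_zero)

lemma lookup_single_mult:
  fixes g :: "('x, 'k::comm_ring_1) mpoly"
  shows "Poly_Mapping.lookup (Poly_Mapping.single m a * g) t =
    (if m \<preceq> t then a * Poly_Mapping.lookup g (t - m) else 0)"
proof -
  have "Poly_Mapping.single m a * g =
      (\<Sum>r\<in>Poly_Mapping.keys g. Poly_Mapping.single (m + r) (a * Poly_Mapping.lookup g r))"
    by (subst poly_eq_sum_single[of g]) (simp add: sum_distrib_left mult_single)
  then have "Poly_Mapping.lookup (Poly_Mapping.single m a * g) t =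
      (\<Sum>r\<in>Poly_Mapping.keys g. if m + r = t then a * Poly_Mapping.lookup g r else 0)"
    by (simp add: lookup_sum lookup_single when_def)
  also have "\<dots> = (\<Sum>r\<in>Poly_Mapping.keys g. if m \<preceq> t \<and> r = t - m then a * Poly_Mapping.lookup g r else 0)"
    by (intro sum.cong refl if_cong) (auto simp: mon_dvd_add_diff)
  also have "\<dots> = (if m \<preceq> t then a * Poly_Mapping.lookup g (t - m) else 0)"
    by (cases "m \<preceq> t") (simp_all add: in_keys_iff)
  finally show ?thesis .
qed

lemma lookup_mult_zero:
  fixes f g :: "('x, 'k::comm_ring_1) mpoly"
  shows "Poly_Mapping.lookup (f * g) 0 = Poly_Mapping.lookup f 0 * Poly_Mapping.lookup g 0"
proof -
  have z: "m \<preceq> 0 \<longleftrightarrow> m = 0" for m :: "'x mon"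
    by (auto intro: mon_dvd_antisym)
  have "f * g = (\<Sum>m\<in>Poly_Mapping.keys f. Poly_Mapping.single m (Poly_Mapping.lookup f m) * g)"
    by (subst poly_eq_sum_single[of f]) (simp add: sum_distrib_right)
  then show ?thesis
    by (simp add: lookup_sum lookup_single_mult z in_keys_iff)
qed

interpretation poly_module: module "(*) :: ('x, 'k::comm_ring_1) mpoly \<Rightarrow> _ \<Rightarrow> _"
  by unfold_locales (simp_all add: algebra_simps)

lemma irrelevant_ideal_eq:
  "irrelevant_ideal = {f :: ('x::finite, 'k::field) mpoly. Poly_Mapping.lookup f 0 = 0}"
proof
  have "poly_module.subspace {f :: ('x, 'k) mpoly. Poly_Mapping.lookup f 0 = 0}"
    by (auto simp: poly_module.subspace_def lookup_add lookup_mult_zero)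
  moreover have "range (\<lambda>x. monom_poly (Poly_Mapping.single x 1)) \<subseteq>
      {f :: ('x, 'k) mpoly. Poly_Mapping.lookup f 0 = 0}"
    by (auto simp: lookup_single when_def) (metis lookup_single_eq lookup_zero nat.distinct(1))
  ultimately show "irrelevant_ideal \<subseteq> {f :: ('x, 'k) mpoly. Poly_Mapping.lookup f 0 = 0}"
    unfolding irrelevant_ideal_def ideal_gen_def by (rule poly_module.span_minimal[rotated])
next
  show "{f :: ('x, 'k) mpoly. Poly_Mapping.lookup f 0 = 0} \<subseteq> irrelevant_ideal"
  proof
    fix f :: "('x, 'k) mpoly"
    assume f: "f \<in> {f. Poly_Mapping.lookup f 0 = 0}"
    have "Poly_Mapping.single m (Poly_Mapping.lookup f m) \<in> (irrelevant_ideal :: ('x, 'k) mpoly set)"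
      if m: "m \<in> Poly_Mapping.keys f" for m
    proof -
      have "m \<noteq> 0"
        using f m by (auto simp: in_keys_iff)
      then obtain x where x: "Poly_Mapping.lookup m x \<noteq> 0"
        by (metis lookup_zero poly_mapping_eqI)
      have "Poly_Mapping.single x 1 \<preceq> m"
        using x by (auto simp: mon_dvd_def lookup_single when_def)
      then have "Poly_Mapping.single m (Poly_Mapping.lookup f m) =
          Poly_Mapping.single (m - Poly_Mapping.single x 1) (Poly_Mapping.lookup f m) *
          monom_poly (Poly_Mapping.single x 1)"
        by (simp add: mult_single add.commute mon_dvd_add_diff)
      then show ?thesis
        unfolding irrelevant_ideal_def ideal_gen_def
        by (metis poly_module.span_base poly_module.span_scale rangeI)
    qed
    then have "(\<Sum>m\<in>Poly_Mapping.keys f. Poly_Mapping.single m (Poly_Mapping.lookup f m)) \<in> irrelevant_ideal"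
      unfolding irrelevant_ideal_def ideal_gen_def by (rule poly_module.span_sum)
    then show "f \<in> irrelevant_ideal"
      by (metis poly_eq_sum_single)
  qed
qed

definition deg_part :: "int \<Rightarrow> ('x::finite, 'k::field) mpoly \<Rightarrow> ('x, 'k) mpoly" where
  "deg_part d f = (\<Sum>m\<in>Poly_Mapping.keys f.
     if int (mon_deg m) = d then Poly_Mapping.single m (Poly_Mapping.lookup f m) else 0)"

lemma lookup_deg_part:
  "Poly_Mapping.lookup (deg_part d f) m =
    (if int (mon_deg m) = d then Poly_Mapping.lookup f m else 0)"
proof -
  have "Poly_Mapping.lookup (deg_part d f) m = (\<Sum>t\<in>Poly_Mapping.keys f.
      if t = m \<and> int (mon_deg m) = d then Poly_Mapping.lookup f m else 0)"
    unfolding deg_part_def lookup_sum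
    by (intro sum.cong refl) (auto simp: lookup_single when_def)
  then show ?thesis
    by (cases "int (mon_deg m) = d") (simp_all add: in_keys_iff)
qed

lemma homogeneous_iff: "homogeneous f d \<longleftrightarrow>
    (\<forall>m. Poly_Mapping.lookup f m \<noteq> 0 \<longrightarrow> int (mon_deg m) = d)"
  by (auto simp: homogeneous_def in_keys_iff)

lemma homogeneous_zero [simp]: "homogeneous 0 d"
  by (simp add: homogeneous_iff)

lemma homogeneous_deg_part: "homogeneous (deg_part d f) d"
  by (simp add: homogeneous_iff lookup_deg_part)

lemma homogeneous_single: "homogeneous (Poly_Mapping.single m a) (int (mon_deg m))"
  by (auto simp: homogeneous_iff lookup_single when_def)

lemma homogeneous_sum: "(\<And>b. b \<in> B \<Longrightarrow> homogeneous (f b) d) \<Longrightarrow> homogeneous (sum f B) d"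
  unfolding homogeneous_iff lookup_sum by (meson sum.not_neutral_contains_not_neutral)

lemma homogeneous_mult: "homogeneous f d \<Longrightarrow> homogeneous g e \<Longrightarrow> homogeneous (f * g) (d + e)"
  unfolding homogeneous_def
proof
  fix m
  assume f: "\<forall>m\<in>Poly_Mapping.keys f. int (mon_deg m) = d"
    and g: "\<forall>m\<in>Poly_Mapping.keys g. int (mon_deg m) = e"
    and "m \<in> Poly_Mapping.keys (f * g)"
  then obtain s t where "s \<in> Poly_Mapping.keys f" "t \<in> Poly_Mapping.keys g" "m = s + t"
    using keys_mult[of f g] by blast
  then show "int (mon_deg m) = d + e"
    using f g by (simp add: mon_deg_add)
qed

lemma deg_part_homogeneous: "homogeneous f e \<Longrightarrow> deg_part d f = (if d = e then f else 0)"
  by (intro poly_mapping_eqI) (auto simp: lookup_deg_part homogeneous_iff)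

lemma deg_part_sum: "deg_part d (sum f B) = (\<Sum>b\<in>B. deg_part d (f b))"
  by (intro poly_mapping_eqI) (simp add: lookup_deg_part lookup_sum)

lemma deg_part_mult:
  assumes "homogeneous g e"
  shows "deg_part d (f * g) = deg_part (d - e) f * g"
proof -
  have "deg_part d (Poly_Mapping.single m a * g) = deg_part (d - e) (Poly_Mapping.single m a) * g" for m a
    using deg_part_homogeneous[OF homogeneous_mult[OF homogeneous_single[of m a] assms], of d]
      deg_part_homogeneous[OF homogeneous_single[of m a], of "d - e"] by auto
  then show ?thesis
    by (subst (1 2) poly_eq_sum_single[of f]) (simp add: sum_distrib_right deg_part_sum)
qed

section \<open>Augmented complexes\<close>

definition vecs :: "'b set \<Rightarrow> ('b \<Rightarrow> 'a::zero) set" where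
  "vecs B = {v. \<forall>k. k \<notin> B \<longrightarrow> v k = 0}"

text \<open>The rows of the matrix \<open>M\<close> are the images of the basis vectors.\<close>

definition mat_apply :: "'b set \<Rightarrow> ('b \<Rightarrow> 'c \<Rightarrow> 'a::comm_ring_1) \<Rightarrow> ('b \<Rightarrow> 'a) \<Rightarrow> 'c \<Rightarrow> 'a" where
  "mat_apply B M v = (\<lambda>l. \<Sum>k\<in>B. v k * M k l)"

definition unit_vec :: "'b \<Rightarrow> 'b \<Rightarrow> 'a::comm_ring_1" where
  "unit_vec k = (\<lambda>l. if l = k then 1 else 0)"

lemma mat_apply_zero [simp]: "mat_apply B M 0 = 0"
  by (simp add: mat_apply_def fun_eq_iff)

lemma mat_apply_add: "mat_apply B M (v + w) = mat_apply B M v + mat_apply B M w"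
  by (simp add: mat_apply_def fun_eq_iff algebra_simps sum.distrib)

lemma mat_apply_diff: "mat_apply B M (v - w) = mat_apply B M v - mat_apply B M w"
  by (simp add: mat_apply_def fun_eq_iff algebra_simps sum_subtractf)

lemma sum_apply: "(\<Sum>x\<in>X. f x) y = (\<Sum>x\<in>X. f x y)"
  by (induction X rule: infinite_finite_induct) simp_all

lemma mat_apply_sum: "mat_apply B M (sum f X) = (\<Sum>x\<in>X. mat_apply B M (f x))"
  by (induction X rule: infinite_finite_induct)
    (simp_all only: sum.infinite sum.empty sum.insert mat_apply_add mat_apply_zero not_False_eq_True)

lemma mat_apply_mat_apply: "mat_apply C N (mat_apply B M v) = mat_apply B (\<lambda>k. mat_apply C N (M k)) v"
proof
  fix l
  have "(\<Sum>j\<in>C. (\<Sum>k\<in>B. v k * M k j) * N j l) = (\<Sum>j\<in>C. \<Sum>k\<in>B. v k * (M k j * N j l))"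
    by (simp add: sum_distrib_right mult.assoc)
  also have "\<dots> = (\<Sum>k\<in>B. \<Sum>j\<in>C. v k * (M k j * N j l))"
    by (rule sum.swap)
  finally show "mat_apply C N (mat_apply B M v) l = mat_apply B (\<lambda>k. mat_apply C N (M k)) v l"
    by (simp add: mat_apply_def sum_distrib_left)
qed

lemma mat_apply_cong: "(\<And>k. k \<in> B \<Longrightarrow> M k = N k) \<Longrightarrow> mat_apply B M v = mat_apply B N v"
  by (simp add: mat_apply_def)

lemma mat_apply_unit_vec: "finite B \<Longrightarrow> k \<in> B \<Longrightarrow> mat_apply B M (unit_vec k) = M k"
  by (simp add: mat_apply_def unit_vec_def fun_eq_iff if_distrib[of "\<lambda>x. x * _"] cong: if_cong)

lemma mat_apply_identity: "finite B \<Longrightarrow> v \<in> vecs B \<Longrightarrow> mat_apply B unit_vec v = v"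
  by (auto simp: mat_apply_def unit_vec_def vecs_def fun_eq_iff if_distrib cong: if_cong)

lemma mat_apply_in_vecs: "(\<And>k. k \<in> B \<Longrightarrow> M k \<in> vecs C) \<Longrightarrow> mat_apply B M v \<in> vecs C"
  by (simp add: mat_apply_def vecs_def)

lemma mat_apply_diff_matrix: "mat_apply B (\<lambda>k. M k - N k) v = mat_apply B M v - mat_apply B N v"
  by (simp add: mat_apply_def fun_eq_iff algebra_simps sum_subtractf)

lemma mat_apply_zero_matrix [simp]: "mat_apply B (\<lambda>k. 0) v = 0"
  by (simp add: mat_apply_def fun_eq_iff)

lemma vecs_zero [simp]: "0 \<in> vecs B"
  by (simp add: vecs_def)

lemma vecs_diff: "v \<in> vecs B \<Longrightarrow> w \<in> vecs B \<Longrightarrow> v - w \<in> vecs (B :: 'b set)" for v :: "'b \<Rightarrow> 'a::ab_group_add"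
  by (simp add: vecs_def)

lemma vecs_sum: "(\<And>x. x \<in> X \<Longrightarrow> f x \<in> vecs B) \<Longrightarrow> sum f X \<in> vecs B"
  for f :: "'c \<Rightarrow> 'b \<Rightarrow> 'a::comm_monoid_add"
  by (simp add: vecs_def sum_apply)

lemma unit_vec_in_vecs: "k \<in> B \<Longrightarrow> unit_vec k \<in> vecs B"
  by (auto simp: vecs_def unit_vec_def)

text \<open>
  Level \<open>0\<close> is the ring itself, a free module of rank one into which the augmentation maps, and
  level \<open>i + 1\<close> is \<open>F\<^sub>i\<close>. This makes the augmentation one of the differentials, and every
  argument by induction along the resolution starts with the identity of the ideal.
\<close>

fun basis :: "('x, 'k::field) free_complex \<Rightarrow> nat \<Rightarrow> nat set" where
  "basis F 0 = {0}"
| "basis F (Suc i) = {..<rank F i}"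

fun shift :: "('x, 'k::field) free_complex \<Rightarrow> nat \<Rightarrow> nat \<Rightarrow> int" where
  "shift F 0 k = 0"
| "shift F (Suc i) k = shifts F i ! k"

fun bd :: "('x, 'k::field) free_complex \<Rightarrow> nat \<Rightarrow> nat \<Rightarrow> nat \<Rightarrow> ('x, 'k) mpoly" where
  "bd F 0 k = (\<lambda>l. if l = 0 then aug F k else 0)"
| "bd F (Suc i) k = (\<lambda>l. if l < rank F i then diff F i k l else 0)"

definition bd_map :: "('x, 'k::field) free_complex \<Rightarrow> nat \<Rightarrow> (nat \<Rightarrow> ('x, 'k) mpoly) \<Rightarrow> nat \<Rightarrow> ('x, 'k) mpoly" where
  "bd_map F i = mat_apply (basis F (Suc i)) (bd F i)"

text \<open>With the ideal as the cycles of level \<open>0\<close>, exactness has the same form in all levels.\<close>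

fun cycles :: "('x, 'k::field) mpoly set \<Rightarrow> ('x, 'k) free_complex \<Rightarrow> nat \<Rightarrow> (nat \<Rightarrow> ('x, 'k) mpoly) set" where
  "cycles I F 0 = {v \<in> vecs {0}. v 0 \<in> I}"
| "cycles I F (Suc i) = {v \<in> vecs (basis F (Suc i)). bd_map F i v = 0}"

lemma finite_basis [simp]: "finite (basis F i)"
  by (cases i) simp_all

lemma bd_in_vecs: "bd F i k \<in> vecs (basis F i)"
  by (cases i) (auto simp: vecs_def)

lemma bd_map_in_vecs: "bd_map F i v \<in> vecs (basis F i)"
  unfolding bd_map_def by (intro mat_apply_in_vecs bd_in_vecs)

lemma graded_free_resolution_iff:
  "graded_free_resolution I F \<longleftrightarrow>
    (\<forall>i. \<forall>k\<in>basis F (Suc i). \<forall>l\<in>basis F i.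
      homogeneous (bd F i k l) (shift F (Suc i) k - shift F i l)) \<and>
    (\<forall>i. bd_map F i ` vecs (basis F (Suc i)) = cycles I F i)"
proof -
  have all_nat: "(\<forall>i. P i) \<longleftrightarrow> P 0 \<and> (\<forall>i. P (Suc i))" for P
    using nat.exhaust by metis
  have all_nat2: "(\<forall>i. P i) \<longleftrightarrow> P 0 \<and> P 1 \<and> (\<forall>i. P (Suc (Suc i)))" for P
    using all_nat[of P] all_nat[of "\<lambda>i. P (Suc i)"] by simp
  have vecs_eq: "free_mod F i = vecs (basis F (Suc i))" for i
    by (auto simp: free_mod_def vecs_def)
  have aug: "bd_map F 0 v = (\<lambda>l. if l = 0 then aug_map F v else 0)" for v
    by (auto simp: bd_map_def aug_map_def mat_apply_def fun_eq_iff)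
  have dm: "bd_map F (Suc i) v = diff_map F i v" for i v
    by (auto simp: bd_map_def diff_map_def mat_apply_def fun_eq_iff)
  have im: "bd_map F 0 ` vecs (basis F 1) = cycles I F 0 \<longleftrightarrow> aug_map F ` free_mod F 0 = I"
  proof
    assume L: "bd_map F 0 ` vecs (basis F 1) = cycles I F 0"
    show "aug_map F ` free_mod F 0 = I"
    proof (intro equalityI subsetI)
      fix f assume "f \<in> aug_map F ` free_mod F 0"
      then obtain v where v: "v \<in> vecs (basis F 1)" "f = aug_map F v"
        using vecs_eq[of 0] by auto
      then have "bd_map F 0 v \<in> cycles I F 0"
        using L by blast
      then show "f \<in> I"
        by (simp add: aug v)
    next
      fix f assume "f \<in> I"
      then have "(\<lambda>l. if l = 0 then f else 0) \<in> cycles I F 0"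
        by (simp add: vecs_def)
      then obtain v where "v \<in> vecs (basis F 1)" "bd_map F 0 v = (\<lambda>l. if l = 0 then f else 0)"
        using L by (metis (no_types, lifting) imageE)
      then have "v \<in> free_mod F 0" "f = aug_map F v"
        using vecs_eq[of 0] by (simp_all add: aug) (metis (full_types))
      then show "f \<in> aug_map F ` free_mod F 0"
        by simp
    qed
  next
    assume R: "aug_map F ` free_mod F 0 = I"
    show "bd_map F 0 ` vecs (basis F 1) = cycles I F 0"
    proof (intro equalityI subsetI)
      fix w assume "w \<in> bd_map F 0 ` vecs (basis F 1)"
      then show "w \<in> cycles I F 0"
        using R vecs_eq[of 0] by (auto simp: aug vecs_def)
    next
      fix w assume w: "w \<in> cycles I F 0"
      then obtain v where "v \<in> free_mod F 0" "aug_map F v = w 0"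
        using R by auto
      moreover from this have "bd_map F 0 v = w"
        using w by (auto simp: aug fun_eq_iff vecs_def)
      ultimately show "w \<in> bd_map F 0 ` vecs (basis F 1)"
        using vecs_eq[of 0] by auto
    qed
  qed
  have z: "bd_map F 0 v = (0 :: nat \<Rightarrow> _) \<longleftrightarrow> aug_map F v = 0" for v
    by (auto simp: aug fun_eq_iff)
  have homog: "(\<forall>i. \<forall>k\<in>basis F (Suc i). \<forall>l\<in>basis F i.
      homogeneous (bd F i k l) (shift F (Suc i) k - shift F i l)) \<longleftrightarrow>
    (\<forall>k<rank F 0. homogeneous (aug F k) (shifts F 0 ! k)) \<and>
    (\<forall>i. \<forall>k<rank F (Suc i). \<forall>l<rank F i.
        homogeneous (diff F i k l) (shifts F (Suc i) ! k - shifts F i ! l))"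
    by (subst all_nat) (simp add: Ball_def)
  have "(\<forall>i. bd_map F i ` vecs (basis F (Suc i)) = cycles I F i) \<longleftrightarrow>
    bd_map F 0 ` vecs (basis F 1) = cycles I F 0 \<and>
    bd_map F 1 ` vecs (basis F (Suc 1)) = cycles I F 1 \<and>
    (\<forall>i. bd_map F (Suc (Suc i)) ` vecs (basis F (Suc (Suc (Suc i)))) = cycles I F (Suc (Suc i)))"
    using all_nat2[of "\<lambda>i. bd_map F i ` vecs (basis F (Suc i)) = cycles I F i"] by simp
  also have "\<dots> \<longleftrightarrow> aug_map F ` free_mod F 0 = I \<and>
     diff_map F 0 ` free_mod F 1 = {v \<in> free_mod F 0. aug_map F v = 0} \<and>
     (\<forall>i. diff_map F (Suc i) ` free_mod F (Suc (Suc i)) =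
        {v \<in> free_mod F (Suc i). diff_map F i v = (\<lambda>_. 0)})"
    unfolding im by (simp add: vecs_eq dm z[unfolded zero_fun_def] zero_fun_def del: basis.simps)
  finally show ?thesis
    unfolding homog graded_free_resolution_def by (simp only: conj_assoc)
qed

section \<open>Shifts of minimal resolutions\<close>

lemma resolution_homogeneous:
  assumes "graded_free_resolution I F" "k \<in> basis F (Suc i)" "l \<in> basis F i"
  shows "homogeneous (bd F i k l) (shift F (Suc i) k - shift F i l)"
  using assms unfolding graded_free_resolution_iff by blast

lemma resolution_bd_map:
  assumes "graded_free_resolution I F" "v \<in> vecs (basis F (Suc i))"
  shows "bd_map F i v \<in> cycles I F i"
  using assms unfolding graded_free_resolution_iff by blast

lemma resolution_preimage:
  assumes "graded_free_resolution I F" "v \<in> cycles I F i"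
  obtains w where "w \<in> vecs (basis F (Suc i))" "bd_map F i w = v"
  using assms unfolding graded_free_resolution_iff by (metis imageE)

lemma resolution_row_cycle:
  assumes "graded_free_resolution I F" "k \<in> basis F (Suc i)"
  shows "bd F i k \<in> cycles I F i"
  using resolution_bd_map[OF assms(1) unit_vec_in_vecs[OF assms(2)]] assms(2)
  by (simp add: bd_map_def mat_apply_unit_vec)

lemma cycles_in_vecs: "v \<in> cycles I F i \<Longrightarrow> v \<in> vecs (basis F i)"
  by (cases i) auto

text \<open>
  As the differential is homogeneous, the components of the right degrees of any preimage form a
  preimage again.
\<close>

lemma resolution_homogeneous_preimage:
  assumes F: "graded_free_resolution I F" and v: "v \<in> cycles I F i"
    and hom: "\<And>l. l \<in> basis F i \<Longrightarrow> homogeneous (v l) (d - shift F i l)"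
  obtains w where "w \<in> vecs (basis F (Suc i))" "bd_map F i w = v"
    "\<And>k. k \<in> basis F (Suc i) \<Longrightarrow> homogeneous (w k) (d - shift F (Suc i) k)"
proof -
  obtain w where w: "w \<in> vecs (basis F (Suc i))" "bd_map F i w = v"
    using resolution_preimage[OF F v] .
  define w' where "w' k = deg_part (d - shift F (Suc i) k) (w k)" for k
  have "w' \<in> vecs (basis F (Suc i))"
    using w(1) by (simp add: vecs_def w'_def deg_part_def)
  moreover have "bd_map F i w' l = v l" for l
  proof (cases "l \<in> basis F i")
    case True
    have "v l = deg_part (d - shift F i l) (bd_map F i w l)"
      using deg_part_homogeneous[OF hom[OF True]] w(2) by simp
    also have "\<dots> = (\<Sum>k\<in>basis F (Suc i). deg_part (d - shift F i l) (w k * bd F i k l))"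
      unfolding bd_map_def mat_apply_def by (rule deg_part_sum)
    also have "\<dots> = (\<Sum>k\<in>basis F (Suc i). w' k * bd F i k l)"
      unfolding w'_def
      by (intro sum.cong refl, subst deg_part_mult[OF resolution_homogeneous[OF F _ True]]) simp_all
    finally show ?thesis
      by (simp add: bd_map_def mat_apply_def)
  next
    case False
    then show ?thesis
      using bd_map_in_vecs[of F i w'] cycles_in_vecs[OF v] by (simp add: vecs_def)
  qed
  ultimately show ?thesis
    by (intro that[of w']) (auto simp: w'_def homogeneous_deg_part)
qed

lemma chain_map_from_rows:
  assumes "\<And>k. k \<in> basis F (Suc i) \<Longrightarrow> bd_map G i (N k) = mat_apply (basis F i) M (bd F i k)"
  shows "bd_map G i (mat_apply (basis F (Suc i)) N v) = mat_apply (basis F i) M (bd_map F i v)"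
  using assms unfolding bd_map_def by (simp add: mat_apply_mat_apply del: basis.simps cong: mat_apply_cong)

text \<open>
  \<open>phi\<close> and \<open>psi\<close> are the components in level \<open>i\<close> of chain maps between two resolutions of the
  same ideal, and \<open>h\<close> is the component of a homotopy between \<open>psi \<circ> phi\<close> and the identity. What
  one needs to know about the components in lower levels is contained in the behaviour on cycles.
\<close>

definition comparison_data where
  "comparison_data I F G i phi psi h \<longleftrightarrow>
    (\<forall>k\<in>basis F i. phi k \<in> vecs (basis G i) \<and>
       (\<forall>l\<in>basis G i. homogeneous (phi k l) (shift F i k - shift G i l))) \<and>
    (\<forall>k\<in>basis G i. psi k \<in> vecs (basis F i)) \<and>
    (\<forall>k\<in>basis F i. h k \<in> vecs (basis F (Suc i))) \<and>
    (\<forall>v\<in>cycles I F i. mat_apply (basis F i) phi v \<in> cycles I G i) \<and>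
    (\<forall>v\<in>cycles I G i. mat_apply (basis G i) psi v \<in> cycles I F i) \<and>
    (\<forall>v\<in>cycles I F i. bd_map F i (mat_apply (basis F i) h v) =
       mat_apply (basis G i) psi (mat_apply (basis F i) phi v) - v)"

lemma comparison_base: "comparison_data I F G 0 unit_vec unit_vec (\<lambda>k. 0)"
  by (auto simp: comparison_data_def unit_vec_in_vecs mat_apply_identity bd_map_def unit_vec_def
      homogeneous_iff lookup_one when_def mat_apply_def vecs_def fun_eq_iff split: if_splits)

text \<open>
  The rows of \<open>phi'\<close> and \<open>psi'\<close> are preimages of the images of the rows of the differentials, and the
  rows of \<open>h'\<close> are preimages of what \<open>psi' \<circ> phi' - id\<close> and \<open>h\<close> leave over, which is a cycle. The
  second conclusion is the homotopy identity on basis vectors, which need not be cycles.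
\<close>

lemma comparison_step:
  assumes F: "graded_free_resolution I F" and G: "graded_free_resolution I G"
    and data: "comparison_data I F G i phi psi h"
  obtains phi' psi' h' where "comparison_data I F G (Suc i) phi' psi' h'"
    "\<And>k. k \<in> basis F (Suc i) \<Longrightarrow> mat_apply (basis G (Suc i)) psi' (phi' k) - unit_vec k =
       bd_map F (Suc i) (h' k) + mat_apply (basis F i) h (bd F i k)"
proof -
  have phi: "\<And>k. k \<in> basis F i \<Longrightarrow> phi k \<in> vecs (basis G i)"
    "\<And>k l. k \<in> basis F i \<Longrightarrow> l \<in> basis G i \<Longrightarrow> homogeneous (phi k l) (shift F i k - shift G i l)"
    and psi: "\<And>k. k \<in> basis G i \<Longrightarrow> psi k \<in> vecs (basis F i)"
    and h: "\<And>k. k \<in> basis F i \<Longrightarrow> h k \<in> vecs (basis F (Suc i))"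
    and phi_cycles: "\<And>v. v \<in> cycles I F i \<Longrightarrow> mat_apply (basis F i) phi v \<in> cycles I G i"
    and psi_cycles: "\<And>v. v \<in> cycles I G i \<Longrightarrow> mat_apply (basis G i) psi v \<in> cycles I F i"
    and h_cycles: "\<And>v. v \<in> cycles I F i \<Longrightarrow>
      bd_map F i (mat_apply (basis F i) h v) = mat_apply (basis G i) psi (mat_apply (basis F i) phi v) - v"
    using data unfolding comparison_data_def by blast+
  have "\<exists>w. w \<in> vecs (basis G (Suc i)) \<and> bd_map G i w = mat_apply (basis F i) phi (bd F i k) \<and>
      (\<forall>l\<in>basis G (Suc i). homogeneous (w l) (shift F (Suc i) k - shift G (Suc i) l))"
    if k: "k \<in> basis F (Suc i)" for k
  proof (rule resolution_homogeneous_preimage[OF G phi_cycles[OF resolution_row_cycle[OF F k]]])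
    fix l assume l: "l \<in> basis G i"
    show "homogeneous (mat_apply (basis F i) phi (bd F i k) l) (shift F (Suc i) k - shift G i l)"
      unfolding mat_apply_def
    proof (rule homogeneous_sum)
      fix j assume j: "j \<in> basis F i"
      show "homogeneous (bd F i k j * phi j l) (shift F (Suc i) k - shift G i l)"
        using homogeneous_mult[OF resolution_homogeneous[OF F k j] phi(2)[OF j l]] by simp
    qed
  qed blast
  then obtain phi' where phi': "\<And>k. k \<in> basis F (Suc i) \<Longrightarrow> phi' k \<in> vecs (basis G (Suc i))"
    "\<And>k. k \<in> basis F (Suc i) \<Longrightarrow> bd_map G i (phi' k) = mat_apply (basis F i) phi (bd F i k)"
    "\<And>k l. k \<in> basis F (Suc i) \<Longrightarrow> l \<in> basis G (Suc i) \<Longrightarrow>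
      homogeneous (phi' k l) (shift F (Suc i) k - shift G (Suc i) l)"
    by metis
  have "\<exists>w. w \<in> vecs (basis F (Suc i)) \<and> bd_map F i w = mat_apply (basis G i) psi (bd G i k)"
    if "k \<in> basis G (Suc i)" for k
    using resolution_preimage[OF F psi_cycles[OF resolution_row_cycle[OF G that]]] by metis
  then obtain psi' where psi': "\<And>k. k \<in> basis G (Suc i) \<Longrightarrow> psi' k \<in> vecs (basis F (Suc i))"
    "\<And>k. k \<in> basis G (Suc i) \<Longrightarrow> bd_map F i (psi' k) = mat_apply (basis G i) psi (bd G i k)"
    by metis
  have phi'_bd: "bd_map G i (mat_apply (basis F (Suc i)) phi' v) = mat_apply (basis F i) phi (bd_map F i v)"
    for v
    by (rule chain_map_from_rows) (rule phi'(2))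
  have psi'_bd: "bd_map F i (mat_apply (basis G (Suc i)) psi' v) = mat_apply (basis G i) psi (bd_map G i v)"
    for v
    by (rule chain_map_from_rows) (rule psi'(2))
  have "\<exists>w. w \<in> vecs (basis F (Suc (Suc i))) \<and>
      bd_map F (Suc i) w = mat_apply (basis G (Suc i)) psi' (phi' k) - unit_vec k - mat_apply (basis F i) h (bd F i k)"
    if k: "k \<in> basis F (Suc i)" for k
  proof -
    let ?v = "mat_apply (basis G (Suc i)) psi' (phi' k) - unit_vec k - mat_apply (basis F i) h (bd F i k)"
    have "bd_map F i ?v = mat_apply (basis G i) psi (bd_map G i (phi' k)) - bd F i k
        - bd_map F i (mat_apply (basis F i) h (bd F i k))"
      using psi'_bd mat_apply_unit_vec[OF finite_basis k, of "bd F i"]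
      by (simp add: bd_map_def mat_apply_diff del: basis.simps)
    also have "\<dots> = 0"
      using h_cycles[OF resolution_row_cycle[OF F k]] phi'(2)[OF k] by simp
    finally have "?v \<in> cycles I F (Suc i)"
      using k psi'(1) h by (simp add: vecs_diff mat_apply_in_vecs unit_vec_in_vecs del: basis.simps)
    then show ?thesis
      using resolution_preimage[OF F] by metis
  qed
  then obtain h' where h': "\<And>k. k \<in> basis F (Suc i) \<Longrightarrow> h' k \<in> vecs (basis F (Suc (Suc i)))"
    "\<And>k. k \<in> basis F (Suc i) \<Longrightarrow> bd_map F (Suc i) (h' k) =
      mat_apply (basis G (Suc i)) psi' (phi' k) - unit_vec k - mat_apply (basis F i) h (bd F i k)"
    by metis
  have "bd_map F (Suc i) (mat_apply (basis F (Suc i)) h' v) =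
      mat_apply (basis G (Suc i)) psi' (mat_apply (basis F (Suc i)) phi' v) - v"
    if v: "v \<in> cycles I F (Suc i)" for v
  proof -
    have v': "v \<in> vecs (basis F (Suc i))" "bd_map F i v = 0"
      using v by simp_all
    have "bd_map F (Suc i) (mat_apply (basis F (Suc i)) h' v) =
        mat_apply (basis F (Suc i)) (\<lambda>k. bd_map F (Suc i) (h' k)) v"
      unfolding bd_map_def by (rule mat_apply_mat_apply)
    also have "\<dots> = mat_apply (basis F (Suc i)) (\<lambda>k. mat_apply (basis G (Suc i)) psi' (phi' k) - unit_vec k
        - mat_apply (basis F i) h (bd F i k)) v"
      by (rule mat_apply_cong) (rule h'(2))
    also have "\<dots> = mat_apply (basis G (Suc i)) psi' (mat_apply (basis F (Suc i)) phi' v) - v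
        - mat_apply (basis F i) h (bd_map F i v)"
      by (simp only: mat_apply_diff_matrix mat_apply_mat_apply bd_map_def mat_apply_identity[OF finite_basis v'(1)])
    finally show ?thesis
      using v'(2) by simp
  qed
  moreover have "mat_apply (basis F (Suc i)) phi' v \<in> cycles I G (Suc i)" if "v \<in> cycles I F (Suc i)" for v
    using that phi'(1) phi'_bd by (simp add: mat_apply_in_vecs del: basis.simps)
  moreover have "mat_apply (basis G (Suc i)) psi' v \<in> cycles I F (Suc i)" if "v \<in> cycles I G (Suc i)" for v
    using that psi'(1) psi'_bd by (simp add: mat_apply_in_vecs del: basis.simps)
  ultimately have "comparison_data I F G (Suc i) phi' psi' h'"
    unfolding comparison_data_def using phi'(1,3) psi'(1) h'(1) by blast
  then show ?thesis
    using h'(2) by (intro that[of phi' psi' h']) auto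
qed

lemma minimal_bd_const:
  assumes "minimal_graded_free_resolution I F" "k \<in> basis F (Suc (Suc i))"
  shows "Poly_Mapping.lookup (bd F (Suc i) k l) 0 = 0"
  using assms by (auto simp: minimal_graded_free_resolution_def irrelevant_ideal_eq)

text \<open>
  By minimality both summands of the homotopy identity vanish modulo \<open>(x\<^sub>1, \<dots>, x\<^sub>n)\<close>, so the
  constant term of the diagonal entry \<open>k\<close> of \<open>psi \<circ> phi\<close> is \<open>1\<close>. Hence some entry in row \<open>k\<close> of \<open>phi\<close>
  has a nonzero constant term, and since that entry is homogeneous its degree, a difference of two
  shifts, is \<open>0\<close>.
\<close>

theorem minimal_shifts_subset:
  assumes F: "minimal_graded_free_resolution I F" and G: "graded_free_resolution I G"
  shows "set (shifts F i) \<subseteq> set (shifts G i)"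
proof -
  have F': "graded_free_resolution I F"
    using F by (simp add: minimal_graded_free_resolution_def)
  \<comment> \<open>The entries of the augmentation may be nonzero constants, namely if \<open>I\<close> is the unit ideal;
    there the homotopy itself is \<open>0\<close>.\<close>
  have "\<exists>phi psi h. comparison_data I F G i phi psi h \<and> (i = 0 \<longrightarrow> h = (\<lambda>k. 0))" for i
  proof (induction i)
    case 0
    show ?case
      using comparison_base by blast
  next
    case (Suc i)
    then obtain phi psi h where "comparison_data I F G i phi psi h"
      by blast
    from comparison_step[OF F' G this] show ?case
      by (metis nat.distinct(1))
  qed
  then obtain phi psi h where data: "comparison_data I F G i phi psi h" and h0: "i = 0 \<Longrightarrow> h = (\<lambda>k. 0)"
    by blast
  obtain phi' psi' h' where
    data': "comparison_data I F G (Suc i) phi' psi' h'"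
    and eq: "\<And>k. k \<in> basis F (Suc i) \<Longrightarrow> mat_apply (basis G (Suc i)) psi' (phi' k) - unit_vec k =
       bd_map F (Suc i) (h' k) + mat_apply (basis F i) h (bd F i k)"
    using comparison_step[OF F' G data] by blast
  have "shift F (Suc i) k \<in> set (shifts G i)" if k: "k \<in> basis F (Suc i)" for k
  proof -
    have 1: "Poly_Mapping.lookup (bd_map F (Suc i) (h' k) k) 0 = 0"
      unfolding bd_map_def mat_apply_def lookup_sum lookup_mult_zero
      by (intro sum.neutral ballI) (simp add: minimal_bd_const[OF F] del: basis.simps bd.simps)
    have 2: "Poly_Mapping.lookup (mat_apply (basis F i) h (bd F i k) k) 0 = 0"
    proof (cases i)
      case 0
      then show ?thesis
        using h0 by simp
    next
      case (Suc j)
      then show ?thesis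
        using k minimal_bd_const[OF F, of k j]
        by (simp add: mat_apply_def lookup_sum lookup_mult_zero del: basis.simps bd.simps)
    qed
    have "mat_apply (basis G (Suc i)) psi' (phi' k) k =
        unit_vec k k + (bd_map F (Suc i) (h' k) k + mat_apply (basis F i) h (bd F i k) k)"
      using fun_cong[OF eq[OF k], of k] by (simp add: algebra_simps)
    then have "Poly_Mapping.lookup (mat_apply (basis G (Suc i)) psi' (phi' k) k) 0 = 1"
      by (simp add: lookup_add 1 2 unit_vec_def)
    then have "(\<Sum>l\<in>basis G (Suc i). Poly_Mapping.lookup (phi' k l) 0 *
        Poly_Mapping.lookup (psi' l k) 0) \<noteq> 0"
      by (simp add: mat_apply_def lookup_sum lookup_mult_zero del: basis.simps)
    then obtain l where l: "l \<in> basis G (Suc i)" "Poly_Mapping.lookup (phi' k l) 0 \<noteq> 0"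
      by (metis (no_types, lifting) mult_zero_left sum.neutral)
    then have "homogeneous (phi' k l) (shift F (Suc i) k - shift G (Suc i) l)"
      using data' k unfolding comparison_data_def by blast
    then have "shift F (Suc i) k = shift G (Suc i) l"
      using l(2) unfolding homogeneous_iff by fastforce
    then show ?thesis
      using l(1) by (simp add: rank_def)
  qed
  then show ?thesis
    by (auto simp: rank_def in_set_conv_nth)
qed

text \<open>
  A basis vector is not mapped to zero: otherwise it would be a boundary, and boundaries have
  coordinates without constant term. So some entry of its row is nonzero, and by minimality that
  entry has positive degree.
\<close>

lemma minimal_shift_ge:
  assumes F: "minimal_graded_free_resolution I F" and F0: "\<And>j. j \<in> set (shifts F 0) \<Longrightarrow> 0 \<le> j"
  shows "j \<in> set (shifts F i) \<Longrightarrow> int i \<le> j"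
proof (induction i arbitrary: j)
  case 0
  then show ?case
    using F0 by simp
next
  case (Suc i)
  have F': "graded_free_resolution I F"
    using F by (simp add: minimal_graded_free_resolution_def)
  obtain k where k: "k \<in> basis F (Suc (Suc i))" "j = shift F (Suc (Suc i)) k"
    using Suc.prems by (auto simp: in_set_conv_nth rank_def)
  have "bd F (Suc i) k \<noteq> 0"
  proof
    assume "bd F (Suc i) k = 0"
    then have "unit_vec k \<in> cycles I F (Suc (Suc i))"
      using k(1) by (simp add: unit_vec_in_vecs bd_map_def mat_apply_unit_vec zero_fun_def
          del: basis.simps bd.simps)
    then obtain w where "bd_map F (Suc (Suc i)) w = unit_vec k"
      using resolution_preimage[OF F'] by metis
    then have "Poly_Mapping.lookup (bd_map F (Suc (Suc i)) w k) 0 = 1"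
      by (simp add: unit_vec_def)
    then show False
      by (simp add: bd_map_def mat_apply_def lookup_sum lookup_mult_zero minimal_bd_const[OF F]
          del: basis.simps bd.simps)
  qed
  then obtain l where l: "bd F (Suc i) k l \<noteq> 0"
    by (auto simp: fun_eq_iff)
  then have l': "l \<in> basis F (Suc i)"
    using bd_in_vecs[of F "Suc i" k] unfolding vecs_def by blast
  obtain m where m: "Poly_Mapping.lookup (bd F (Suc i) k l) m \<noteq> 0"
    using l by (metis lookup_zero poly_mapping_eqI)
  then have "m \<noteq> 0"
    using minimal_bd_const[OF F k(1)] by metis
  then have "mon_deg m \<noteq> 0"
    by (simp add: mon_deg_eq_0_iff)
  moreover have "int (mon_deg m) = j - shift F (Suc i) l"
    using resolution_homogeneous[OF F' k(1) l'] m k(2) unfolding homogeneous_iff by blast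
  moreover have "int i \<le> shift F (Suc i) l"
    using l' by (intro Suc.IH) (simp add: rank_def)
  ultimately show ?case
    by simp
qed

section \<open>Multigraded complexes\<close>

lemma monomial_ideal_iff:
  "f \<in> ideal_gen (monom_poly ` U :: ('x, 'k::field) mpoly set) \<longleftrightarrow>
    (\<forall>m. Poly_Mapping.lookup f m \<noteq> 0 \<longrightarrow> (\<exists>g\<in>U. g \<preceq> m))"
proof
  let ?T = "{f :: ('x, 'k) mpoly. \<forall>m. Poly_Mapping.lookup f m \<noteq> 0 \<longrightarrow> (\<exists>g\<in>U. g \<preceq> m)}"
  have "poly_module.subspace ?T"
    unfolding poly_module.subspace_def
  proof (intro conjI ballI allI)
    fix f g :: "('x, 'k) mpoly" assume f: "f \<in> ?T" and g: "g \<in> ?T"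
    show "f + g \<in> ?T"
    proof safe
      fix m assume "Poly_Mapping.lookup (f + g) m \<noteq> 0"
      then have "Poly_Mapping.lookup f m \<noteq> 0 \<or> Poly_Mapping.lookup g m \<noteq> 0"
        by (auto simp: lookup_add)
      then show "\<exists>g\<in>U. g \<preceq> m"
        using f g by blast
    qed
  next
    fix c f :: "('x, 'k) mpoly" assume f: "f \<in> ?T"
    show "c * f \<in> ?T"
    proof safe
      fix m assume "Poly_Mapping.lookup (c * f) m \<noteq> 0"
      then obtain s t where "t \<in> Poly_Mapping.keys f" "m = s + t"
        using keys_mult[of c f] by (auto simp: in_keys_iff[symmetric])
      moreover from this obtain g where "g \<in> U" "g \<preceq> t"
        using f by (auto simp: in_keys_iff)
      ultimately show "\<exists>g\<in>U. g \<preceq> m"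
        by (meson mon_dvd_add(2) mon_dvd_trans)
    qed
  qed simp
  moreover have "monom_poly ` U \<subseteq> ?T"
    by (auto simp: lookup_single when_def split: if_splits) (metis mon_dvd_refl)
  ultimately have "ideal_gen (monom_poly ` U) \<subseteq> ?T"
    unfolding ideal_gen_def by (rule poly_module.span_minimal[rotated])
  then show "f \<in> ideal_gen (monom_poly ` U) \<Longrightarrow>
      \<forall>m. Poly_Mapping.lookup f m \<noteq> 0 \<longrightarrow> (\<exists>g\<in>U. g \<preceq> m)"
    by blast
next
  assume *: "\<forall>m. Poly_Mapping.lookup f m \<noteq> 0 \<longrightarrow> (\<exists>g\<in>U. g \<preceq> m)"
  have "Poly_Mapping.single m (Poly_Mapping.lookup f m) \<in> ideal_gen (monom_poly ` U)"
    if m: "m \<in> Poly_Mapping.keys f" for m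
  proof -
    obtain g where g: "g \<in> U" "g \<preceq> m"
      using * m by (auto simp: in_keys_iff)
    then have "Poly_Mapping.single m (Poly_Mapping.lookup f m) =
        Poly_Mapping.single (m - g) (Poly_Mapping.lookup f m) * monom_poly g"
      by (simp add: mult_single add.commute mon_dvd_add_diff)
    then show ?thesis
      unfolding ideal_gen_def using g(1) poly_module.span_base poly_module.span_scale by (metis imageI)
  qed
  then have "(\<Sum>m\<in>Poly_Mapping.keys f. Poly_Mapping.single m (Poly_Mapping.lookup f m)) \<in>
      ideal_gen (monom_poly ` U)"
    unfolding ideal_gen_def by (rule poly_module.span_sum)
  then show "f \<in> ideal_gen (monom_poly ` U)"
    by (metis poly_eq_sum_single)
qed

text \<open>
  If the basis element \<open>b\<close> has multidegree \<open>\<sigma> b\<close>, then \<open>chains B \<sigma> m\<close> is the component in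
  multidegree \<open>m\<close> of the free module with basis \<open>B\<close>: the vector \<open>a\<close> stands for the sum of the terms
  \<open>a\<^sub>b x\<^sup>m\<^sup>-\<^sup>\<sigma>\<^sup>b\<close>.
\<close>

definition chains :: "'b set \<Rightarrow> ('b \<Rightarrow> 'x mon) \<Rightarrow> 'x mon \<Rightarrow> ('b \<Rightarrow> 'k::field) set" where
  "chains B \<sigma> m = {a \<in> vecs B. \<forall>b. a b \<noteq> 0 \<longrightarrow> \<sigma> b \<preceq> m}"

fun strand_cycles ::
  "'x mon set \<Rightarrow> (nat \<Rightarrow> 'b set) \<Rightarrow> (nat \<Rightarrow> 'b \<Rightarrow> 'x mon) \<Rightarrow> (nat \<Rightarrow> 'b \<Rightarrow> 'b \<Rightarrow> 'k::field) \<Rightarrow>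
    nat \<Rightarrow> 'x mon \<Rightarrow> ('b \<Rightarrow> 'k) set" where
  "strand_cycles U B \<sigma> c 0 m = {a \<in> chains (B 0) (\<sigma> 0) m. a = 0 \<or> (\<exists>g\<in>U. g \<preceq> m)}"
| "strand_cycles U B \<sigma> c (Suc i) m = {a \<in> chains (B (Suc i)) (\<sigma> (Suc i)) m. mat_apply (B (Suc i)) (c i) a = 0}"

text \<open>
  A multigraded complex is given by matrices \<open>c\<close> over the field and by the multidegrees \<open>\<sigma>\<close>, which
  determine the monomials in the entries over the polynomial ring. Exactness can be tested in each
  multidegree, where it is a statement about vector spaces. The enumeration \<open>e\<close> serves only to turn
  arbitrary index sets into initial segments of the natural numbers.
\<close>

locale multigraded_resolution =
  fixes U :: "'x::finite mon set"
    and B :: "nat \<Rightarrow> 'b set"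
    and \<sigma> :: "nat \<Rightarrow> 'b \<Rightarrow> 'x mon"
    and c :: "nat \<Rightarrow> 'b \<Rightarrow> 'b \<Rightarrow> 'k::field"
    and e :: "nat \<Rightarrow> nat \<Rightarrow> 'b"
  assumes enum: "bij_betw (e i) {..<card (B i)} (B i)"
    and card_0: "card (B 0) = 1"
    and deg_0: "b \<in> B 0 \<Longrightarrow> \<sigma> 0 b = 0"
    and rows: "b \<in> B (Suc i) \<Longrightarrow> c i b \<in> chains (B i) (\<sigma> i) (\<sigma> (Suc i) b)"
    and exact: "mat_apply (B (Suc i)) (c i) ` chains (B (Suc i)) (\<sigma> (Suc i)) m = strand_cycles U B \<sigma> c i m"
begin

definition F :: "('x, 'k) free_complex" where
  "F = \<lparr>shifts = \<lambda>i. map (\<lambda>k. int (mon_deg (\<sigma> (Suc i) (e (Suc i) k)))) [0..<card (B (Suc i))],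
     aug = \<lambda>k. Poly_Mapping.single (\<sigma> 1 (e 1 k)) (c 0 (e 1 k) (e 0 0)),
     diff = \<lambda>i k l. Poly_Mapping.single (\<sigma> (Suc (Suc i)) (e (Suc (Suc i)) k) - \<sigma> (Suc i) (e (Suc i) l))
       (c (Suc i) (e (Suc (Suc i)) k) (e (Suc i) l))\<rparr>"

lemma e_in: "k < card (B i) \<Longrightarrow> e i k \<in> B i"
  using enum[of i] by (auto simp: bij_betw_def)

lemma basis_F: "basis F i = {..<card (B i)}"
  by (cases i) (auto simp: card_0 rank_def F_def)

lemma shift_F: "k < card (B i) \<Longrightarrow> shift F i k = int (mon_deg (\<sigma> i (e i k)))"
  using e_in[of k 0] by (cases i) (simp_all add: F_def deg_0)

lemma bd_F: "bd F i k l = (if l < card (B i)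
    then Poly_Mapping.single (\<sigma> (Suc i) (e (Suc i) k) - \<sigma> i (e i l)) (c i (e (Suc i) k) (e i l)) else 0)"
  using e_in[of 0 0] by (cases i) (simp_all add: F_def rank_def card_0 deg_0)

lemma c_nonzero:
  assumes "b \<in> B (Suc i)" "c i b b' \<noteq> 0"
  shows "\<sigma> i b' \<preceq> \<sigma> (Suc i) b"
  using rows[OF assms(1)] assms(2) by (simp add: chains_def)

text \<open>
  The translation between polynomial vectors and their components: \<open>vec\<close> embeds the component in
  multidegree \<open>m\<close>, and \<open>part\<close> projects onto it.
\<close>

definition vec :: "nat \<Rightarrow> 'x mon \<Rightarrow> ('b \<Rightarrow> 'k) \<Rightarrow> nat \<Rightarrow> ('x, 'k) mpoly" where
  "vec i m a = (\<lambda>k. if k < card (B i) then Poly_Mapping.single (m - \<sigma> i (e i k)) (a (e i k)) else 0)"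

definition part :: "nat \<Rightarrow> 'x mon \<Rightarrow> (nat \<Rightarrow> ('x, 'k) mpoly) \<Rightarrow> 'b \<Rightarrow> 'k" where
  "part i m v = (\<lambda>b. if b \<in> B i \<and> \<sigma> i b \<preceq> m
     then Poly_Mapping.lookup (v (inv_into {..<card (B i)} (e i) b)) (m - \<sigma> i b) else 0)"

lemma part_in_chains: "part i m v \<in> chains (B i) (\<sigma> i) m"
  by (simp add: part_def chains_def vecs_def)

lemma part_e: "k < card (B i) \<Longrightarrow> part i m v (e i k) =
    (if \<sigma> i (e i k) \<preceq> m then Poly_Mapping.lookup (v k) (m - \<sigma> i (e i k)) else 0)"
  using enum[of i] by (simp add: part_def e_in inv_into_f_f bij_betw_def)

lemma B_cases:
  assumes "b \<in> B i" obtains k where "k < card (B i)" "b = e i k"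
  using assms enum[of i] unfolding bij_betw_def by (metis imageE lessThan_iff)

lemma part_sum: "part i m (sum f X) = (\<Sum>x\<in>X. part i m (f x))"
proof (induction X rule: infinite_finite_induct)
  case (insert x X)
  have "part i m (v + w) = part i m v + part i m w" for v w
    by (simp add: part_def fun_eq_iff lookup_add)
  with insert show ?case
    by (simp only: sum.insert not_False_eq_True)
qed (simp_all add: part_def fun_eq_iff)

lemma vec_in_vecs: "vec i m a \<in> vecs (basis F i)"
  by (simp add: vec_def vecs_def basis_F)

lemma part_vec:
  assumes "a \<in> chains (B i) (\<sigma> i) m"
  shows "part i m' (vec i m a) = (if m = m' then a else 0)"
proof
  fix b
  show "part i m' (vec i m a) b = (if m = m' then a else 0) b"
  proof (cases "b \<in> B i")
    case False
    then show ?thesis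
      using assms by (simp add: part_def chains_def vecs_def)
  next
    case True
    then obtain k where k: "k < card (B i)" "b = e i k"
      by (rule B_cases)
    have "a b = 0 \<or> \<sigma> i b \<preceq> m"
      using assms by (auto simp: chains_def)
    moreover have "m = m'" if "\<sigma> i b \<preceq> m" "\<sigma> i b \<preceq> m'" "m - \<sigma> i b = m' - \<sigma> i b"
      using that by (metis mon_dvd_add_diff)
    ultimately show ?thesis
      using k by (auto simp: part_e vec_def lookup_single when_def)
  qed
qed

text \<open>
  The decomposition is stated for all large enough finite sets \<open>T\<close>, so that any prescribed
  multidegree can be assumed to be among those that are summed over.
\<close>

lemma vec_sum_parts:
  assumes v: "v \<in> vecs (basis F i)"
  obtains S where "finite S" "\<And>T. finite T \<Longrightarrow> S \<subseteq> T \<Longrightarrow> v = (\<Sum>m\<in>T. vec i m (part i m v))"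
proof
  define S where "S = (\<Union>k<card (B i). (\<lambda>t. \<sigma> i (e i k) + t) ` Poly_Mapping.keys (v k))"
  show "finite S"
    by (simp add: S_def)
  fix T assume T: "finite T" "S \<subseteq> T"
  show "v = (\<Sum>m\<in>T. vec i m (part i m v))"
  proof
    fix k
    show "v k = (\<Sum>m\<in>T. vec i m (part i m v)) k"
    proof (cases "k < card (B i)")
      case False
      then show ?thesis
        using v by (simp add: sum_apply vec_def vecs_def basis_F)
    next
      case True
      show ?thesis
      proof (rule poly_mapping_eqI)
        fix t
        have "Poly_Mapping.lookup ((\<Sum>m\<in>T. vec i m (part i m v)) k) t =
            (\<Sum>m\<in>T. if m = \<sigma> i (e i k) + t then Poly_Mapping.lookup (v k) t else 0)"
          using True
          by (auto simp: sum_apply lookup_sum vec_def part_e lookup_single when_def mon_dvd_add_diff intro!: sum.cong)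
        also have "\<dots> = Poly_Mapping.lookup (v k) t"
        proof (cases "\<sigma> i (e i k) + t \<in> T")
          case False
          then have "t \<notin> Poly_Mapping.keys (v k)"
            using T(2) True by (auto simp: S_def)
          then show ?thesis
            by (simp add: in_keys_iff cong: if_cong)
        qed (use T in simp)
        finally show "Poly_Mapping.lookup (v k) t =
            Poly_Mapping.lookup ((\<Sum>m\<in>T. vec i m (part i m v)) k) t"
          by simp
      qed
    qed
  qed
qed

lemma bd_map_vec:
  assumes a: "a \<in> chains (B (Suc i)) (\<sigma> (Suc i)) m"
  shows "bd_map F i (vec (Suc i) m a) = vec i m (mat_apply (B (Suc i)) (c i) a)"
proof
  fix l
  show "bd_map F i (vec (Suc i) m a) l = vec i m (mat_apply (B (Suc i)) (c i) a) l"
  proof (cases "l < card (B i)")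
    case False
    then show ?thesis
      by (simp add: bd_map_def mat_apply_def bd_F vec_def)
  next
    case True
    have single: "(\<Sum>k\<in>X. Poly_Mapping.single t (f k)) = Poly_Mapping.single t (sum f X)"
      for X :: "nat set" and t :: "'x mon" and f :: "nat \<Rightarrow> 'k"
      by (intro poly_mapping_eqI) (simp add: lookup_sum lookup_single when_def)
    have term_eq: "Poly_Mapping.single (m - \<sigma> (Suc i) (e (Suc i) k)) (a (e (Suc i) k)) *
        Poly_Mapping.single (\<sigma> (Suc i) (e (Suc i) k) - \<sigma> i (e i l)) (c i (e (Suc i) k) (e i l)) =
        Poly_Mapping.single (m - \<sigma> i (e i l)) (a (e (Suc i) k) * c i (e (Suc i) k) (e i l))"
      if "k < card (B (Suc i))" for k
    proof (cases "a (e (Suc i) k) = 0 \<or> c i (e (Suc i) k) (e i l) = 0")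
      case False
      then have "\<sigma> (Suc i) (e (Suc i) k) \<preceq> m" "\<sigma> i (e i l) \<preceq> \<sigma> (Suc i) (e (Suc i) k)"
        using a c_nonzero[OF e_in[OF that]] by (auto simp: chains_def)
      then show ?thesis
        by (simp add: mult_single mon_diff_add_diff)
    qed auto
    have "bd_map F i (vec (Suc i) m a) l = (\<Sum>k<card (B (Suc i)).
        Poly_Mapping.single (m - \<sigma> i (e i l)) (a (e (Suc i) k) * c i (e (Suc i) k) (e i l)))"
      unfolding bd_map_def mat_apply_def basis_F
      by (intro sum.cong refl) (simp add: bd_F vec_def True term_eq)
    also have "\<dots> = Poly_Mapping.single (m - \<sigma> i (e i l))
        (\<Sum>k<card (B (Suc i)). a (e (Suc i) k) * c i (e (Suc i) k) (e i l))"
      by (rule single)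
    also have "(\<Sum>k<card (B (Suc i)). a (e (Suc i) k) * c i (e (Suc i) k) (e i l)) =
        mat_apply (B (Suc i)) (c i) a (e i l)"
      unfolding mat_apply_def by (rule sum.reindex_bij_betw[OF enum])
    finally show ?thesis
      using True by (simp add: vec_def)
  qed
qed

lemma mat_apply_c_in_chains:
  assumes "a \<in> chains (B (Suc i)) (\<sigma> (Suc i)) m"
  shows "mat_apply (B (Suc i)) (c i) a \<in> chains (B i) (\<sigma> i) m"
proof -
  have "mat_apply (B (Suc i)) (c i) a \<in> strand_cycles U B \<sigma> c i m"
    using exact assms by blast
  then show ?thesis
    by (cases i) auto
qed

text \<open>
  The differential respects multidegrees. By this fact, cycles and boundaries can be compared one
  multidegree at a time.
\<close>

lemma part_bd_map:
  assumes v: "v \<in> vecs (basis F (Suc i))"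
  shows "part i m (bd_map F i v) = mat_apply (B (Suc i)) (c i) (part (Suc i) m v)"
proof -
  obtain S where S: "finite S"
    "\<And>T. finite T \<Longrightarrow> S \<subseteq> T \<Longrightarrow> v = (\<Sum>m\<in>T. vec (Suc i) m (part (Suc i) m v))"
    using vec_sum_parts[OF v] by blast
  have sum: "bd_map F i (sum f X) = (\<Sum>x\<in>X. bd_map F i (f x))"
    for X :: "'x mon set" and f :: "'x mon \<Rightarrow> nat \<Rightarrow> ('x, 'k) mpoly"
    unfolding bd_map_def by (rule mat_apply_sum)
  have "part i m (bd_map F i v) =
      part i m (bd_map F i (\<Sum>t\<in>insert m S. vec (Suc i) t (part (Suc i) t v)))"
    by (intro arg_cong[of v _ "\<lambda>v. part i m (bd_map F i v)"] S(2)) (use S(1) in auto)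
  also have "\<dots> = (\<Sum>t\<in>insert m S. if t = m then mat_apply (B (Suc i)) (c i) (part (Suc i) t v) else 0)"
    unfolding sum part_sum
    by (intro sum.cong refl) (simp only: bd_map_vec part_in_chains part_vec mat_apply_c_in_chains)
  also have "\<dots> = mat_apply (B (Suc i)) (c i) (part (Suc i) m v)"
    using S(1) by (subst sum.delta) simp_all
  finally show ?thesis .
qed

lemma vec_zero: "vec i m 0 = 0"
  by (simp add: vec_def fun_eq_iff)

lemma eq_zero_if_parts_zero:
  assumes "v \<in> vecs (basis F i)" "\<And>m. part i m v = 0"
  shows "v = 0"
proof -
  obtain S where "finite S" "\<And>T. finite T \<Longrightarrow> S \<subseteq> T \<Longrightarrow> v = (\<Sum>m\<in>T. vec i m (part i m v))"
    using vec_sum_parts[OF assms(1)] by blast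
  then have "v = (\<Sum>m\<in>S. vec i m (part i m v))"
    by blast
  then show ?thesis
    by (simp only: assms(2) vec_zero sum.neutral_const)
qed

lemma cycles_iff:
  "v \<in> cycles (ideal_gen (monom_poly ` U)) F i \<longleftrightarrow>
    v \<in> vecs (basis F i) \<and> (\<forall>m. part i m v \<in> strand_cycles U B \<sigma> c i m)"
proof (cases i)
  case (Suc j)
  have "bd_map F j v = 0 \<longleftrightarrow> (\<forall>m. mat_apply (B i) (c j) (part i m v) = 0)" if v: "v \<in> vecs (basis F i)"
  proof
    assume "bd_map F j v = 0"
    moreover have "part j m 0 = 0" for m
      by (simp add: part_def fun_eq_iff)
    ultimately show "\<forall>m. mat_apply (B i) (c j) (part i m v) = 0"
      using part_bd_map[of v j] v Suc by (simp del: basis.simps)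
  next
    assume "\<forall>m. mat_apply (B i) (c j) (part i m v) = 0"
    then have "part j m (bd_map F j v) = 0" for m
      using part_bd_map[of v j m] v Suc by (simp del: basis.simps)
    then show "bd_map F j v = 0"
      by (rule eq_zero_if_parts_zero[OF bd_map_in_vecs])
  qed
  then show ?thesis
    unfolding Suc cycles.simps strand_cycles.simps using part_in_chains by blast
next
  case 0
  have 1: "0 < card (B 0)" "\<And>b. b \<in> B 0 \<Longrightarrow> b = e 0 0"
    using B_cases[of _ 0] by (auto simp: card_0)
  have "part 0 m v (e 0 0) = Poly_Mapping.lookup (v 0) m" for m
    using 1 by (simp add: part_e deg_0 e_in)
  moreover have "part 0 m v = 0 \<longleftrightarrow> part 0 m v (e 0 0) = 0" for m
  proof
    assume "part 0 m v (e 0 0) = 0"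
    then have "part 0 m v b = 0" for b
      using 1(2)[of b] by (cases "b \<in> B 0") (simp, simp add: part_def)
    then show "part 0 m v = 0"
      by (simp add: fun_eq_iff)
  qed simp
  ultimately have "part 0 m v = 0 \<longleftrightarrow> Poly_Mapping.lookup (v 0) m = 0" for m
    by simp
  then show ?thesis
    unfolding 0 cycles.simps strand_cycles.simps basis.simps mem_Collect_eq monomial_ideal_iff
    using part_in_chains by blast
qed

theorem graded_free_resolution_F: "graded_free_resolution (ideal_gen (monom_poly ` U)) F"
  unfolding graded_free_resolution_iff
proof (intro conjI allI ballI)
  fix i k l
  assume k: "k \<in> basis F (Suc i)" and l: "l \<in> basis F i"
  show "homogeneous (bd F i k l) (shift F (Suc i) k - shift F i l)"
  proof (cases "c i (e (Suc i) k) (e i l) = 0")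
    case False
    then show ?thesis
      using k l c_nonzero[OF e_in, OF _ False]
      by (simp add: basis_F bd_F shift_F mon_deg_diff[symmetric] homogeneous_single
          del: basis.simps shift.simps bd.simps)
  qed (simp add: bd_F)
next
  fix i
  show "bd_map F i ` vecs (basis F (Suc i)) = cycles (ideal_gen (monom_poly ` U)) F i"
  proof (intro equalityI subsetI)
    fix v assume "v \<in> bd_map F i ` vecs (basis F (Suc i))"
    then obtain w where w: "v = bd_map F i w" "w \<in> vecs (basis F (Suc i))"
      by blast
    then have "part i m v \<in> strand_cycles U B \<sigma> c i m" for m
      using exact[of i m] part_bd_map[OF w(2)] part_in_chains[of "Suc i" m w] by blast
    then show "v \<in> cycles (ideal_gen (monom_poly ` U)) F i"
      unfolding cycles_iff w(1) by (simp add: bd_map_in_vecs)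
  next
    fix v assume v: "v \<in> cycles (ideal_gen (monom_poly ` U)) F i"
    then have v': "v \<in> vecs (basis F i)" "\<And>m. part i m v \<in> strand_cycles U B \<sigma> c i m"
      unfolding cycles_iff by auto
    have "\<exists>a. a \<in> chains (B (Suc i)) (\<sigma> (Suc i)) m \<and> mat_apply (B (Suc i)) (c i) a = part i m v" for m
      using v'(2)[of m] unfolding exact[symmetric] by auto
    then obtain a where a: "\<And>m. a m \<in> chains (B (Suc i)) (\<sigma> (Suc i)) m"
      "\<And>m. mat_apply (B (Suc i)) (c i) (a m) = part i m v"
      by metis
    obtain S where "finite S" "\<And>T. finite T \<Longrightarrow> S \<subseteq> T \<Longrightarrow> v = (\<Sum>m\<in>T. vec i m (part i m v))"
      using vec_sum_parts[OF v'(1)] by blast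
    then have S: "v = (\<Sum>m\<in>S. vec i m (part i m v))"
      by blast
    have "bd_map F i (\<Sum>m\<in>S. vec (Suc i) m (a m)) = (\<Sum>m\<in>S. bd_map F i (vec (Suc i) m (a m)))"
      unfolding bd_map_def by (rule mat_apply_sum)
    also have "\<dots> = v"
      unfolding bd_map_vec[OF a(1)] a(2) by (rule S[symmetric])
    finally have eq: "v = bd_map F i (\<Sum>m\<in>S. vec (Suc i) m (a m))"
      by (rule sym)
    have "(\<Sum>m\<in>S. vec (Suc i) m (a m)) \<in> vecs (basis F (Suc i))"
      by (intro vecs_sum vec_in_vecs)
    then show "v \<in> bd_map F i ` vecs (basis F (Suc i))"
      unfolding eq by (rule imageI)
  qed
qed

lemma minimal_F:
  assumes "\<And>i b b'. b \<in> B (Suc (Suc i)) \<Longrightarrow> b' \<in> B (Suc i) \<Longrightarrow>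
    \<sigma> (Suc (Suc i)) b = \<sigma> (Suc i) b' \<Longrightarrow> c (Suc i) b b' = 0"
  shows "minimal_graded_free_resolution (ideal_gen (monom_poly ` U)) F"
  unfolding minimal_graded_free_resolution_def
proof (intro conjI allI impI graded_free_resolution_F)
  fix i k l
  assume kl: "k < rank F (Suc i)" "l < rank F i"
  let ?b = "e (Suc (Suc i)) k" and ?b' = "e (Suc i) l"
  have b: "?b \<in> B (Suc (Suc i))" "?b' \<in> B (Suc i)"
    using kl by (auto simp: rank_def F_def e_in)
  show "diff F i k l \<in> irrelevant_ideal"
  proof (cases "c (Suc i) ?b ?b' = 0")
    case False
    then have "\<sigma> (Suc i) ?b' \<preceq> \<sigma> (Suc (Suc i)) ?b" "\<sigma> (Suc i) ?b' \<noteq> \<sigma> (Suc (Suc i)) ?b"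
      using b assms[of ?b i ?b'] c_nonzero by auto
    then have "\<sigma> (Suc (Suc i)) ?b - \<sigma> (Suc i) ?b' \<noteq> 0"
      by (metis add.right_neutral mon_dvd_add_diff)
    then show ?thesis
      by (simp add: irrelevant_ideal_eq F_def lookup_single when_def)
  qed (simp add: irrelevant_ideal_eq F_def)
qed

lemma shifts_F: "set (shifts F i) = (\<lambda>b. int (mon_deg (\<sigma> (Suc i) b))) ` B (Suc i)"
proof -
  have "(\<lambda>b. int (mon_deg (\<sigma> (Suc i) b))) ` B (Suc i) =
      (\<lambda>b. int (mon_deg (\<sigma> (Suc i) b))) ` e (Suc i) ` {..<card (B (Suc i))}"
    using enum[of "Suc i"] by (simp add: bij_betw_def)
  then show ?thesis
    by (simp add: F_def atLeast0LessThan image_image)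
qed

end

section \<open>Existence of minimal resolutions\<close>

lemma squarefree_mon_dvd_iff:
  assumes "squarefree_mon s"
  shows "s \<preceq> m \<longleftrightarrow> supp s \<subseteq> supp m"
proof
  assume sub: "supp s \<subseteq> supp m"
  have "Poly_Mapping.lookup s x \<le> Poly_Mapping.lookup m x" for x
  proof (cases "x \<in> supp s")
    case True
    then have "x \<in> supp m"
      using sub by blast
    then have "Poly_Mapping.lookup m x \<noteq> 0"
      by (simp add: in_keys_iff)
    moreover have "Poly_Mapping.lookup s x \<le> 1"
      using assms by (simp add: squarefree_mon_def)
    ultimately show ?thesis
      by simp
  qed (simp add: in_keys_iff)
  then show "s \<preceq> m"
    by (simp add: mon_dvd_def)
next
  assume "s \<preceq> m"
  then show "supp s \<subseteq> supp m"
    unfolding mon_dvd_def in_keys_iff subset_iff by (metis le_zero_eq)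
qed

lemma finite_squarefree_mons: "finite {s :: 'x::finite mon. squarefree_mon s}"
proof (rule finite_imageD)
  show "inj_on supp {s :: 'x mon. squarefree_mon s}"
    by (auto simp: inj_on_def intro!: mon_dvd_antisym simp: squarefree_mon_dvd_iff)
qed simp

text \<open>
  A squarefree monomial divides \<open>m\<close> iff it divides the radical of \<open>m\<close>. So whatever is generated in
  squarefree multidegrees is the same in multidegree \<open>m\<close> as in the squarefree multidegree \<open>mon_rad m\<close>.
\<close>

lift_definition mon_rad :: "'x::finite mon \<Rightarrow> 'x mon" is "\<lambda>m x. min (m x) 1"
  by simp

lemma squarefree_mon_rad: "squarefree_mon (mon_rad m)"
  by (simp add: squarefree_mon_def mon_rad.rep_eq)

lemma squarefree_dvd_rad_iff: "squarefree_mon s \<Longrightarrow> s \<preceq> mon_rad m \<longleftrightarrow> s \<preceq> m"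
  by (simp add: squarefree_mon_def mon_dvd_def mon_rad.rep_eq)

lemma mon_rad_dvd: "mon_rad m \<preceq> m"
  by (simp add: mon_dvd_def mon_rad.rep_eq)

interpretation fun_space: vector_space "\<lambda>(a::'k::field) (v::nat \<Rightarrow> 'k) k. a * v k"
  by unfold_locales (simp_all add: fun_eq_iff algebra_simps)

lemma chains_iff: "a \<in> chains B \<sigma> m \<longleftrightarrow> a \<in> vecs B \<and> (\<forall>b\<in>B. a b \<noteq> 0 \<longrightarrow> \<sigma> b \<preceq> m)"
  by (auto simp: chains_def vecs_def)

lemma chains_subspace: "fun_space.subspace (chains B \<sigma> m)"
  by (auto simp: fun_space.subspace_def chains_def vecs_def) (metis add_0)

lemma mat_apply_scale: "mat_apply B M (\<lambda>k. a * v k) = (\<lambda>l. a * mat_apply B M v l)"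
  by (simp add: mat_apply_def sum_distrib_left mult.assoc)

lemma mat_apply_image_subspace:
  assumes V: "fun_space.subspace V"
  shows "fun_space.subspace (mat_apply B M ` V)"
proof (rule fun_space.subspaceI)
  show "0 \<in> mat_apply B M ` V"
    by (rule image_eqI[of _ _ 0]) (simp_all add: fun_space.subspace_0[OF V])
next
  fix x y assume "x \<in> mat_apply B M ` V" "y \<in> mat_apply B M ` V"
  then obtain v w where "v \<in> V" "x = mat_apply B M v" "w \<in> V" "y = mat_apply B M w"
    by blast
  then show "x + y \<in> mat_apply B M ` V"
    by (intro image_eqI[of _ _ "v + w"]) (simp_all only: mat_apply_add fun_space.subspace_add[OF V])
next
  fix a x assume "x \<in> mat_apply B M ` V"
  then obtain v where "v \<in> V" "x = mat_apply B M v"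
    by blast
  then show "(\<lambda>k. a * x k) \<in> mat_apply B M ` V"
    by (intro image_eqI[of _ _ "\<lambda>k. a * v k"]) (simp_all only: mat_apply_scale fun_space.subspace_scale[OF V])
qed

text \<open>
  The components of a multigraded submodule of a free module of rank \<open>r\<close> that is generated in
  squarefree multidegrees.
\<close>

definition squarefree_family :: "nat \<Rightarrow> (nat \<Rightarrow> 'x::finite mon) \<Rightarrow> ('x mon \<Rightarrow> (nat \<Rightarrow> 'k::field) set) \<Rightarrow> bool" where
  "squarefree_family r \<sigma> Z \<longleftrightarrow>
    (\<forall>m. fun_space.subspace (Z m) \<and> Z m \<subseteq> chains {..<r} \<sigma> m \<and> Z m = Z (mon_rad m)) \<and>
    (\<forall>m m'. m \<preceq> m' \<longrightarrow> Z m \<subseteq> Z m')"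

text \<open>
  A free module mapped onto the submodule \<open>Z\<close>, with basis in squarefree multidegrees. The last
  condition is minimality: a relation between the generators involves no generator of the
  multidegree of the relation, that is, no generator with a unit coefficient.
\<close>

definition minimal_cover ::
  "('x::finite mon \<Rightarrow> (nat \<Rightarrow> 'k::field) set) \<Rightarrow> nat \<Rightarrow> (nat \<Rightarrow> 'x mon) \<Rightarrow> (nat \<Rightarrow> nat \<Rightarrow> 'k) \<Rightarrow> bool" where
  "minimal_cover Z r \<sigma> c \<longleftrightarrow>
    (\<forall>k<r. squarefree_mon (\<sigma> k) \<and> c k \<in> Z (\<sigma> k)) \<and>
    (\<forall>m. mat_apply {..<r} c ` chains {..<r} \<sigma> m = Z m) \<and>
    (\<forall>m. \<forall>b\<in>chains {..<r} \<sigma> m. mat_apply {..<r} c b = 0 \<longrightarrow> (\<forall>k<r. \<sigma> k = m \<longrightarrow> b k = 0))"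

lemma finite_span_chains:
  assumes "fun_space.subspace V" "V \<subseteq> chains {..<r} \<sigma> m"
  obtains X where "finite X" "X \<subseteq> V" "V \<subseteq> fun_space.span X"
proof -
  have "v \<in> fun_space.span (unit_vec ` {..<r})" if "v \<in> V" for v
  proof -
    have "v = (\<Sum>k<r. (\<lambda>l. v k * unit_vec k l))"
      using that assms(2)
      by (auto simp: fun_eq_iff sum_apply unit_vec_def chains_def vecs_def if_distrib cong: if_cong)
    also have "\<dots> \<in> fun_space.span (unit_vec ` {..<r})"
      by (intro fun_space.span_sum fun_space.span_scale fun_space.span_base) auto
    finally show ?thesis .
  qed
  moreover obtain X where "X \<subseteq> V" "fun_space.independent X" "V \<subseteq> fun_space.span X"
    using fun_space.maximal_independent_subset by blast
  ultimately show ?thesis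
    using that fun_space.independent_span_bound[of "unit_vec ` {..<r}" X] by blast
qed

text \<open>
  Bases of the finitely many components in squarefree multidegrees generate the submodule. A
  generating set of minimal cardinality is as required: a generator that occurs in a relation with
  a unit coefficient could be expressed by the others and left out.
\<close>

lemma minimal_cover_exists:
  fixes Z :: "'x::finite mon \<Rightarrow> (nat \<Rightarrow> 'k::field) set"
  assumes "squarefree_family r \<sigma> Z"
  obtains r' \<sigma>' c where "minimal_cover Z r' \<sigma>' c"
proof -
  have sub: "fun_space.subspace (Z m)" and fin: "Z m \<subseteq> chains {..<r} \<sigma> m"
    and rad: "Z m = Z (mon_rad m)" and mono: "m \<preceq> m' \<Longrightarrow> Z m \<subseteq> Z m'" for m m'
    using assms by (auto simp: squarefree_family_def)
  define gens where "gens P m = {z. \<exists>s. (s, z) \<in> P \<and> s \<preceq> m}" for P :: "('x mon \<times> (nat \<Rightarrow> 'k)) set" and m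
  define generates where "generates P \<longleftrightarrow> finite P \<and>
      (\<forall>(s, z)\<in>P. squarefree_mon s \<and> z \<in> Z s) \<and> (\<forall>m. Z m \<subseteq> fun_space.span (gens P m))"
    for P :: "('x mon \<times> (nat \<Rightarrow> 'k)) set"
  have "\<exists>X. finite X \<and> X \<subseteq> Z m \<and> Z m \<subseteq> fun_space.span X" for m
    using finite_span_chains[OF sub fin] by metis
  then obtain X where X: "\<And>m. finite (X m)" "\<And>m. X m \<subseteq> Z m" "\<And>m. Z m \<subseteq> fun_space.span (X m)"
    by metis
  have "generates (Sigma {s. squarefree_mon s} X)"
    unfolding generates_def
  proof (intro conjI allI)
    show "finite (Sigma {s. squarefree_mon s} X)"
      using finite_squarefree_mons X(1) by blast
    show "\<forall>(s, z)\<in>Sigma {s. squarefree_mon s} X. squarefree_mon s \<and> z \<in> Z s"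
      using X(2) by auto
    fix m
    have "X (mon_rad m) \<subseteq> gens (Sigma {s. squarefree_mon s} X) m"
      using squarefree_mon_rad[of m] mon_rad_dvd[of m] by (auto simp: gens_def)
    then show "Z m \<subseteq> fun_space.span (gens (Sigma {s. squarefree_mon s} X) m)"
      using X(3)[of "mon_rad m"] rad[of m] fun_space.span_mono by blast
  qed
  then obtain P where P: "generates P" and least: "\<And>P'. generates P' \<Longrightarrow> card P \<le> card P'"
    using ex_has_least_nat[of generates _ card] by blast
  have finP: "finite P" and P_Z: "\<And>s z. (s, z) \<in> P \<Longrightarrow> squarefree_mon s \<and> z \<in> Z s"
    and P_span: "\<And>m. Z m \<subseteq> fun_space.span (gens P m)"
    using P by (auto simp: generates_def)
  obtain f where f: "bij_betw f {..<card P} P"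
    using ex_bij_betw_nat_finite[OF finP] by (auto simp: atLeast0LessThan)
  define \<sigma>' where "\<sigma>' k = fst (f k)" for k
  define c where "c k = snd (f k)" for k
  have f_P: "(\<sigma>' k, c k) \<in> P" if "k < card P" for k
    using that f by (auto simp: \<sigma>'_def c_def bij_betw_def)
  have P_f: "\<exists>k<card P. s = \<sigma>' k \<and> z = c k" if "(s, z) \<in> P" for s z
    using that f unfolding \<sigma>'_def c_def bij_betw_def
    by (metis (no_types, lifting) fst_conv imageE lessThan_iff snd_conv)
  have mat_apply_eq: "mat_apply {..<card P} c b = (\<Sum>k<card P. (\<lambda>l. b k * c k l))" for b
    by (simp add: mat_apply_def fun_eq_iff sum_apply)
  have "minimal_cover Z (card P) \<sigma>' c"
    unfolding minimal_cover_def
  proof (intro conjI allI impI ballI)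
    fix k assume "k < card P"
    then show "squarefree_mon (\<sigma>' k)" "c k \<in> Z (\<sigma>' k)"
      using P_Z[OF f_P] by auto
  next
    fix m
    let ?im = "mat_apply {..<card P} c ` chains {..<card P} \<sigma>' m"
    show "?im = Z m"
    proof
      show "?im \<subseteq> Z m"
      proof clarify
        fix b :: "nat \<Rightarrow> 'k"
        assume b: "b \<in> chains {..<card P} \<sigma>' m"
        have "(\<lambda>l. b k * c k l) \<in> Z m" if k: "k < card P" for k
        proof (cases "b k = 0")
          case True
          then show ?thesis
            using fun_space.subspace_0[OF sub[of m]] by (simp add: zero_fun_def)
        next
          case False
          then have "c k \<in> Z m"
            using b P_Z[OF f_P[OF k]] mono[of "\<sigma>' k" m] by (auto simp: chains_def)
          then show ?thesis
            by (rule fun_space.subspace_scale[OF sub])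
        qed
        then show "mat_apply {..<card P} c b \<in> Z m"
          unfolding mat_apply_eq by (intro fun_space.subspace_sum[OF sub]) simp
      qed
    next
      have "fun_space.subspace ?im"
        by (rule mat_apply_image_subspace[OF chains_subspace])
      moreover have "gens P m \<subseteq> ?im"
      proof
        fix z assume "z \<in> gens P m"
        then obtain k where k: "k < card P" "\<sigma>' k \<preceq> m" "z = c k"
          using P_f by (auto simp: gens_def)
        have "unit_vec k \<in> chains {..<card P} \<sigma>' m"
          using k by (auto simp: chains_def vecs_def unit_vec_def)
        moreover have "z = mat_apply {..<card P} c (unit_vec k)"
          using k by (simp add: mat_apply_unit_vec)
        ultimately show "z \<in> ?im"
          by blast
      qed
      ultimately have "fun_space.span (gens P m) \<subseteq> ?im"
        by (rule fun_space.span_minimal[rotated])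
      then show "Z m \<subseteq> ?im"
        using P_span by blast
    qed
  next
    fix m b k
    assume b: "b \<in> chains {..<card P} \<sigma>' m" "mat_apply {..<card P} c b = 0"
      and k: "k < card P" "\<sigma>' k = m"
    show "b k = 0"
    proof (rule ccontr)
      assume nz: "b k \<noteq> 0"
      let ?P = "P - {(\<sigma>' k, c k)}"
      have c_k: "c k \<in> fun_space.span (gens ?P m)"
      proof -
        have "0 = (\<Sum>j<card P. (\<lambda>l. b j * c j l))"
          using b(2) by (simp only: mat_apply_eq)
        also have "\<dots> = (\<lambda>l. b k * c k l) + (\<Sum>j\<in>{..<card P} - {k}. (\<lambda>l. b j * c j l))"
          using k by (intro sum.remove) auto
        finally have "0 = (\<lambda>l. b k * c k l) + (\<Sum>j\<in>{..<card P} - {k}. (\<lambda>l. b j * c j l))" .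
        then have "c k = (\<lambda>l. - (1 / b k) * (\<Sum>j\<in>{..<card P} - {k}. (\<lambda>l. b j * c j l)) l)"
          using nz by (auto simp: fun_eq_iff field_simps eq_neg_iff_add_eq_0)
        also have "\<dots> \<in> fun_space.span (gens ?P m)"
        proof (rule fun_space.span_scale, rule fun_space.span_sum)
          fix j assume j: "j \<in> {..<card P} - {k}"
          show "(\<lambda>l. b j * c j l) \<in> fun_space.span (gens ?P m)"
          proof (cases "b j = 0")
            case True
            then show ?thesis
              using fun_space.span_zero by (simp add: zero_fun_def)
          next
            case False
            have "f j \<noteq> f k"
              using j k f by (auto simp: bij_betw_def inj_on_def)
            then have "(\<sigma>' j, c j) \<in> ?P"
              using j f_P[of j] by (auto simp: \<sigma>'_def c_def prod_eq_iff)
            moreover have "\<sigma>' j \<preceq> m"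
              using b(1) False by (simp add: chains_def)
            ultimately have "c j \<in> gens ?P m"
              by (auto simp: gens_def)
            then show ?thesis
              by (intro fun_space.span_scale fun_space.span_base)
          qed
        qed
        finally show ?thesis .
      qed
      have "generates ?P"
        unfolding generates_def
      proof (intro conjI allI)
        fix t
        have "z \<in> fun_space.span (gens ?P t)" if z: "z \<in> gens P t" for z
        proof -
          obtain s where s: "(s, z) \<in> P" "s \<preceq> t"
            using z by (auto simp: gens_def)
          show ?thesis
          proof (cases "(s, z) = (\<sigma>' k, c k)")
            case True
            then have "gens ?P m \<subseteq> gens ?P t"
              using s(2) k(2) mon_dvd_trans by (auto simp: gens_def)
            then show ?thesis
              using True c_k fun_space.span_mono by blast
          next
            case False
            then show ?thesis
              using s by (intro fun_space.span_base) (auto simp: gens_def)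
          qed
        qed
        then have "fun_space.span (gens P t) \<subseteq> fun_space.span (gens ?P t)"
          by (intro fun_space.span_minimal) auto
        then show "Z t \<subseteq> fun_space.span (gens ?P t)"
          using P_span by blast
      qed (use finP P_Z in auto)
      from least[OF this] show False
        using finP f_P[OF k(1)] by (meson card_Diff1_less leD)
    qed
  qed
  then show ?thesis
    by (rule that)
qed

text \<open>The syzygies are again of the kind one started with, which allows one to iterate.\<close>

lemma squarefree_family_kernel:
  fixes Z :: "'x::finite mon \<Rightarrow> (nat \<Rightarrow> 'k::field) set"
  assumes "minimal_cover Z r \<sigma> c"
  shows "squarefree_family r \<sigma> (\<lambda>m. {b \<in> chains {..<r} \<sigma> m. mat_apply {..<r} c b = 0})"
proof -
  have rad: "\<sigma> k \<preceq> mon_rad m \<longleftrightarrow> \<sigma> k \<preceq> m" if "k \<in> {..<r}" for k m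
  proof -
    have "squarefree_mon (\<sigma> k)"
      using assms that by (simp add: minimal_cover_def)
    then show ?thesis
      by (rule squarefree_dvd_rad_iff)
  qed
  have "chains {..<r} \<sigma> m = (chains {..<r} \<sigma> (mon_rad m) :: (nat \<Rightarrow> 'k) set)" for m
    using rad by (simp add: set_eq_iff chains_iff)
  moreover have "fun_space.subspace {b \<in> chains {..<r} \<sigma> m. mat_apply {..<r} c b = 0}" for m
    using chains_subspace[of "{..<r}" \<sigma> m]
    by (auto simp: fun_space.subspace_def mat_apply_add mat_apply_scale zero_fun_def mat_apply_zero[unfolded zero_fun_def])
  moreover have "chains {..<r} \<sigma> m \<subseteq> (chains {..<r} \<sigma> m' :: (nat \<Rightarrow> 'k) set)" if "m \<preceq> m'" for m m'
    using that mon_dvd_trans by (auto simp: chains_def)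
  ultimately show ?thesis
    unfolding squarefree_family_def by blast
qed

text \<open>
  Starting with the ideal in level \<open>0\<close>, one covers repeatedly the kernel of the preceding cover.
  The rows of each differential are relations of the preceding one, so minimality of the covers
  says that no entry is a nonzero constant.
\<close>

theorem minimal_resolution_exists:
  fixes U :: "'x::finite mon set"
  assumes U: "\<And>g. g \<in> U \<Longrightarrow> squarefree_mon g"
  obtains F :: "('x, 'k::field) free_complex"
  where "minimal_graded_free_resolution (ideal_gen (monom_poly ` U)) F"
proof -
  define Z0 :: "'x mon \<Rightarrow> (nat \<Rightarrow> 'k) set" where
    "Z0 m = {a \<in> chains {..<1} (\<lambda>k. 0) m. a = 0 \<or> (\<exists>g\<in>U. g \<preceq> m)}" for m
  define ker where "ker r \<sigma> c m = {b \<in> chains {..<r} \<sigma> m. mat_apply {..<r} c b = 0}"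
    for r and \<sigma> :: "nat \<Rightarrow> 'x mon" and c :: "nat \<Rightarrow> nat \<Rightarrow> 'k" and m
  define P where "P n S \<longleftrightarrow> (case S of (r, \<sigma>, Z) \<Rightarrow> squarefree_family r \<sigma> Z \<and>
      (n = 0 \<longrightarrow> r = 1 \<and> \<sigma> = (\<lambda>k. 0) \<and> Z = Z0))"
    for n :: nat and S :: "nat \<times> (nat \<Rightarrow> 'x mon) \<times> ('x mon \<Rightarrow> (nat \<Rightarrow> 'k) set)"
  define Q where "Q S S' \<longleftrightarrow> (case S of (r, \<sigma>, Z) \<Rightarrow> case S' of (r', \<sigma>', Z') \<Rightarrow>
      (\<exists>c. minimal_cover Z r' \<sigma>' c \<and> Z' = ker r' \<sigma>' c))"
    for S S' :: "nat \<times> (nat \<Rightarrow> 'x mon) \<times> ('x mon \<Rightarrow> (nat \<Rightarrow> 'k) set)"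
  have "squarefree_family 1 (\<lambda>k. 0) Z0"
    unfolding squarefree_family_def
  proof (intro conjI allI impI)
    fix m m' :: "'x mon"
    show "fun_space.subspace (Z0 m)"
      using chains_subspace[of "{..<1}" "\<lambda>k. 0" m] by (auto simp: fun_space.subspace_def Z0_def fun_eq_iff)
    show "Z0 m \<subseteq> chains {..<1} (\<lambda>k. 0) m"
      by (auto simp: Z0_def)
    show "Z0 m = Z0 (mon_rad m)"
      using U squarefree_dvd_rad_iff by (auto simp: Z0_def chains_def)
    assume "m \<preceq> m'"
    then show "Z0 m \<subseteq> Z0 m'"
      using mon_dvd_trans by (auto simp: Z0_def chains_def)
  qed
  then have "P 0 (1, \<lambda>k. 0, Z0)"
    by (simp add: P_def)
  moreover have "\<exists>S'. P (Suc n) S' \<and> Q S S'" if "P n S" for n S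
  proof -
    obtain r \<sigma> Z where S: "S = (r, \<sigma>, Z)"
      by (cases S)
    with that obtain r' \<sigma>' c where "minimal_cover Z r' \<sigma>' c"
      using minimal_cover_exists[of r \<sigma> Z] by (auto simp: P_def)
    then have "P (Suc n) (r', \<sigma>', ker r' \<sigma>' c) \<and> Q S (r', \<sigma>', ker r' \<sigma>' c)"
      using squarefree_family_kernel by (auto simp: P_def Q_def S ker_def[abs_def])
    then show ?thesis
      by blast
  qed
  ultimately obtain S where S: "\<And>n. P n (S n)" "\<And>n. Q (S n) (S (Suc n))"
    using dependent_nat_choice[of P "\<lambda>_. Q"] by metis
  define r where "r n = fst (S n)" for n
  define \<sigma> where "\<sigma> n = fst (snd (S n))" for n
  define Z where "Z n = snd (snd (S n))" for n
  have S_eq: "S n = (r n, \<sigma> n, Z n)" for n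
    by (simp add: r_def \<sigma>_def Z_def)
  have init: "r 0 = 1" "\<sigma> 0 = (\<lambda>k. 0)" "Z 0 = Z0" and fam: "\<And>n. squarefree_family (r n) (\<sigma> n) (Z n)"
    using S(1) by (auto simp: P_def S_eq)
  have "\<exists>c. minimal_cover (Z n) (r (Suc n)) (\<sigma> (Suc n)) c \<and> Z (Suc n) = ker (r (Suc n)) (\<sigma> (Suc n)) c" for n
    using S(2)[of n] by (simp add: Q_def S_eq)
  then obtain c where c: "\<And>n. minimal_cover (Z n) (r (Suc n)) (\<sigma> (Suc n)) (c n)"
    "\<And>n. Z (Suc n) = ker (r (Suc n)) (\<sigma> (Suc n)) (c n)"
    by metis
  have row: "c n k \<in> Z n (\<sigma> (Suc n) k)" if "k < r (Suc n)" for n k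
    using c(1)[of n] that by (simp add: minimal_cover_def)
  interpret res: multigraded_resolution U "\<lambda>n. {..<r n}" \<sigma> c "\<lambda>n k. k"
  proof
    fix n b m
    show "bij_betw (\<lambda>k. k) {..<card {..<r n}} {..<r n}"
      by (simp add: bij_betw_def)
    show "card {..<r 0} = 1" "b \<in> {..<r 0} \<Longrightarrow> \<sigma> 0 b = 0"
      by (simp_all add: init)
    show "c n b \<in> chains {..<r n} (\<sigma> n) (\<sigma> (Suc n) b)" if "b \<in> {..<r (Suc n)}"
      using row[of b n] that fam[of n] by (auto simp: squarefree_family_def)
    have "strand_cycles U (\<lambda>n. {..<r n}) \<sigma> c n m = Z n m"
      by (cases n) (simp_all add: init Z0_def c(2) ker_def)
    then show "mat_apply {..<r (Suc n)} (c n) ` chains {..<r (Suc n)} (\<sigma> (Suc n)) m =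
        strand_cycles U (\<lambda>n. {..<r n}) \<sigma> c n m"
      using c(1)[of n] by (simp add: minimal_cover_def)
  qed
  have "minimal_graded_free_resolution (ideal_gen (monom_poly ` U)) res.F"
  proof (rule res.minimal_F)
    fix n b b'
    assume b: "b \<in> {..<r (Suc (Suc n))}" "b' \<in> {..<r (Suc n)}" "\<sigma> (Suc (Suc n)) b = \<sigma> (Suc n) b'"
    then have "c (Suc n) b \<in> ker (r (Suc n)) (\<sigma> (Suc n)) (c n) (\<sigma> (Suc n) b')"
      using row[of b "Suc n"] c(2) by simp
    then show "c (Suc n) b b' = 0"
      using c(1)[of n] b(2) unfolding minimal_cover_def ker_def by blast
  qed
  then show ?thesis
    by (rule that)
qed

section \<open>Simplicial complexes supporting a resolution\<close>

lemma lookup_mon_lcm: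
  "Poly_Mapping.lookup (mon_lcm U) x = Max (insert 0 ((\<lambda>m. Poly_Mapping.lookup m x) ` U))"
  by (simp add: mon_lcm.rep_eq image_image)

lemma mon_lcm_dvd_iff: "finite U \<Longrightarrow> mon_lcm U \<preceq> m \<longleftrightarrow> (\<forall>g\<in>U. g \<preceq> m)"
  by (auto simp: mon_dvd_def lookup_mon_lcm)

lemma mon_dvd_lcm: "finite U \<Longrightarrow> g \<in> U \<Longrightarrow> g \<preceq> mon_lcm U"
  using mon_lcm_dvd_iff[of U "mon_lcm U"] by simp

definition face_sign :: "nat set \<Rightarrow> nat \<Rightarrow> 'k::comm_ring_1" where
  "face_sign L x = (- 1) ^ card {y \<in> L. y < x}"

lemma face_sign_square: "face_sign L x * (face_sign L x * a) = (a :: 'k::comm_ring_1)"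
  by (simp add: face_sign_def mult.assoc[symmetric] power_mult_distrib[symmetric])

lemma face_sign_insert:
  assumes "finite L" "x \<notin> L"
  shows "face_sign (insert x L) y = (if x < y then - face_sign L y else (face_sign L y :: 'k::comm_ring_1))"
proof -
  have "{z \<in> insert x L. z < y} = (if x < y then insert x {z \<in> L. z < y} else {z \<in> L. z < y})"
    by auto
  then show ?thesis
    using assms by (simp add: face_sign_def)
qed

lemma face_sign_swap:
  assumes "finite L" "x \<notin> L" "y \<notin> L" "x \<noteq> y"
  shows "face_sign L x * face_sign (insert x L) y = - (face_sign L y * face_sign (insert y L) x :: 'k::comm_ring_1)"
  using assms by (auto simp: face_sign_insert mult.commute)

text \<open>
  The boundary of the simplex on the vertex set \<open>V\<close>, including the augmentation: the empty set is
  a face. The coefficient at \<open>L\<close> collects the faces that have \<open>L\<close> as a facet.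
\<close>

definition simplex_bd :: "nat set \<Rightarrow> (nat set \<Rightarrow> 'k::comm_ring_1) \<Rightarrow> nat set \<Rightarrow> 'k" where
  "simplex_bd V a L = (\<Sum>x\<in>V - L. face_sign L x * a (insert x L))"

text \<open>
  The terms cancel in pairs; inferring this from \<open>S = - S\<close> would fail in characteristic \<open>2\<close>.
\<close>

lemma antisymmetric_sum_zero:
  fixes g :: "'b \<Rightarrow> 'b \<Rightarrow> 'k::comm_ring_1"
  assumes "finite W" "\<And>x y. x \<in> W \<Longrightarrow> y \<in> W \<Longrightarrow> x \<noteq> y \<Longrightarrow> g x y = - g y x"
  shows "(\<Sum>x\<in>W. \<Sum>y\<in>W - {x}. g x y) = 0"
  using assms
proof (induction W)
  case (insert w W)
  have "(\<Sum>y\<in>insert w W - {x}. g x y) = g x w + (\<Sum>y\<in>W - {x}. g x y)" if "x \<in> W" for x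
  proof -
    have "insert w W - {x} = insert w (W - {x})"
      using insert.hyps(2) that by auto
    then show ?thesis
      using insert.hyps by simp
  qed
  moreover have "insert w W - {w} = W"
    using insert.hyps(2) by auto
  ultimately have "(\<Sum>x\<in>insert w W. \<Sum>y\<in>insert w W - {x}. g x y) =
      (\<Sum>y\<in>W. g w y) + ((\<Sum>x\<in>W. g x w) + (\<Sum>x\<in>W. \<Sum>y\<in>W - {x}. g x y))"
    using insert.hyps by (simp add: sum.distrib)
  moreover have "(\<Sum>x\<in>W. g x w) = (\<Sum>x\<in>W. - g w x)"
    using insert.prems insert.hyps(2) by (intro sum.cong) auto
  moreover have "(\<Sum>x\<in>W. \<Sum>y\<in>W - {x}. g x y) = 0"
    using insert.IH insert.prems by blast
  ultimately show ?case
    by (simp add: sum_negf)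
qed simp

lemma simplex_bd_bd:
  assumes "finite V" "finite L"
  shows "simplex_bd V (simplex_bd V a) L = (0 :: 'k::comm_ring_1)"
proof -
  define g where "g x y = face_sign L x * face_sign (insert x L) y * a (insert y (insert x L))" for x y
  have "simplex_bd V (simplex_bd V a) L = (\<Sum>x\<in>V - L. \<Sum>y\<in>V - L - {x}. g x y)"
    unfolding simplex_bd_def g_def
    by (intro sum.cong refl) (simp add: sum_distrib_left mult.assoc set_diff_eq conj_ac)
  also have "\<dots> = 0"
  proof (rule antisymmetric_sum_zero)
    fix x y assume "x \<in> V - L" "y \<in> V - L" "x \<noteq> y"
    then show "g x y = - g y x"
      using face_sign_swap[OF assms(2), of x y, where ?'k = 'k] by (simp add: g_def insert_commute)
  qed (use assms in simp)
  finally show ?thesis .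
qed

definition cone :: "nat \<Rightarrow> (nat set \<Rightarrow> 'k::comm_ring_1) \<Rightarrow> nat set \<Rightarrow> 'k" where
  "cone v a J = (if v \<in> J then face_sign (J - {v}) v * a (J - {v}) else 0)"

text \<open>
  This is the homotopy identity \<open>\<partial> \<circ> cone + cone \<circ> \<partial> = id\<close>, applied to a cycle.
\<close>

lemma simplex_bd_cone:
  assumes V: "finite V" "v \<in> V" and L: "finite L" and a: "simplex_bd V a = 0"
  shows "simplex_bd V (cone v a) L = (a L :: 'k::comm_ring_1)"
proof (cases "v \<in> L")
  case False
  have "simplex_bd V (cone v a) L = (\<Sum>x\<in>V - L. if x = v then a L else 0)"
    unfolding simplex_bd_def using False
    by (intro sum.cong refl) (auto simp: cone_def face_sign_square)
  then show ?thesis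
    using V False by simp
next
  case True
  define K where "K = L - {v}"
  have K: "L = insert v K" "v \<notin> K" "finite K"
    using True L by (auto simp: K_def)
  have "0 = (\<Sum>x\<in>V - K. face_sign K x * a (insert x K))"
    using fun_cong[OF a, of K] by (simp add: simplex_bd_def)
  also have "V - K = insert v (V - L)"
    using V K by auto
  finally have cycle: "(\<Sum>x\<in>V - L. face_sign K x * a (insert x K)) = - (face_sign K v * a L)"
    using V K by (simp add: eq_neg_iff_add_eq_0 add.commute)
  have "simplex_bd V (cone v a) L = (\<Sum>x\<in>V - L. - (face_sign K v * (face_sign K x * a (insert x K))))"
    unfolding simplex_bd_def
  proof (intro sum.cong refl)
    fix x assume x: "x \<in> V - L"
    have "insert x L - {v} = insert x K"
      using x K by auto
    then show "face_sign L x * cone v a (insert x L) = - (face_sign K v * (face_sign K x * a (insert x K)))"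
      using x K by (auto simp: cone_def face_sign_insert)
  qed
  also have "\<dots> = - (face_sign K v * (\<Sum>x\<in>V - L. face_sign K x * a (insert x K)))"
    by (simp add: sum_negf sum_distrib_left)
  also have "\<dots> = a L"
    by (simp add: cycle face_sign_square)
  finally show ?thesis .
qed

text \<open>
  In multidegree \<open>m\<close> one finds the augmented chain complex of the faces whose lcm divides \<open>m\<close>. If no
  generator divides \<open>m\<close>, the empty set is the only such face, and \<open>m\<close> is not in the ideal. Otherwise the
  hypothesis \<open>apex\<close> says that these faces form a cone, so that every cycle is the boundary
  of the cone over it.
\<close>

theorem supported_resolution_exists:
  fixes u :: "nat \<Rightarrow> 'x::finite mon" and V :: "nat set" and \<Delta> :: "nat set set"
  assumes V: "finite V" "\<Delta> \<subseteq> Pow V"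
    and empty: "{} \<in> \<Delta>" and down: "\<And>J L. J \<in> \<Delta> \<Longrightarrow> L \<subseteq> J \<Longrightarrow> L \<in> \<Delta>"
    and apex: "\<And>m j. j \<in> V \<Longrightarrow> u j \<preceq> m \<Longrightarrow>
      \<exists>v\<in>V. u v \<preceq> m \<and> (\<forall>J\<in>\<Delta>. mon_lcm (u ` J) \<preceq> m \<longrightarrow> insert v J \<in> \<Delta>)"
  obtains G :: "('x, 'k::field) free_complex"
  where "graded_free_resolution (ideal_gen (monom_poly ` u ` V)) G"
    "\<And>i. set (shifts G i) = (\<lambda>J. int (mon_deg (mon_lcm (u ` J)))) ` {J \<in> \<Delta>. card J = Suc i}"
proof -
  define B where "B i = {J \<in> \<Delta>. card J = i}" for i
  define \<sigma> where "\<sigma> i J = mon_lcm (u ` J)" for i :: nat and J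
  define c :: "nat \<Rightarrow> nat set \<Rightarrow> nat set \<Rightarrow> 'k" where
    "c i J L = (if L \<in> B i \<and> L \<subseteq> J then \<Sum>x\<in>J - L. face_sign L x else 0)" for i J L
  have finJ: "finite J" "J \<subseteq> V" if "J \<in> \<Delta>" for J
    using that V finite_subset by blast+
  have finB: "finite (B i)" for i
    using V finite_subset[of "B i" "Pow V"] by (auto simp: B_def)
  then have "\<exists>f. bij_betw f {..<card (B i)} (B i)" for i
    using ex_bij_betw_nat_finite[of "B i"] by (simp add: atLeast0LessThan)
  then obtain e where e: "\<And>i. bij_betw (e i) {..<card (B i)} (B i)"
    by metis
  have lcm_dvd: "mon_lcm (u ` J) \<preceq> m \<longleftrightarrow> (\<forall>j\<in>J. u j \<preceq> m)" if "J \<in> \<Delta>" for J m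
    using finJ[OF that] by (simp add: mon_lcm_dvd_iff)
  have B_0: "B 0 = {{}}"
    using empty finJ by (auto simp: B_def)
  have mat_apply_c: "mat_apply (B (Suc i)) (c i) a = simplex_bd V a" if a: "a \<in> vecs (B (Suc i))" for i a
  proof
    fix L
    have ins: "L \<in> B i" if "insert x L \<in> B (Suc i)" "x \<notin> L" for x
    proof -
      have "insert x L \<in> \<Delta>"
        using that(1) by (simp add: B_def)
      moreover from this have "finite L"
        using finJ(1)[of "insert x L"] by simp
      ultimately show ?thesis
        using that down by (auto simp: B_def)
    qed
    show "mat_apply (B (Suc i)) (c i) a L = simplex_bd V a L"
    proof (cases "L \<in> B i")
      case False
      then have "a (insert x L) = 0" if "x \<in> V - L" for x
        using ins[of x] that a by (auto simp: vecs_def)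
      then show ?thesis
        using False by (simp add: mat_apply_def c_def simplex_bd_def)
    next
      case True
      have L: "finite L" "card L = i"
        using True finJ by (auto simp: B_def)
      let ?S = "(\<lambda>x. insert x L) ` (V - L)"
      have inj: "inj_on (\<lambda>x. insert x L) (V - L)"
        by (auto simp: inj_on_def)
      have "simplex_bd V a L = (\<Sum>J\<in>?S. a J * (\<Sum>x\<in>J - L. face_sign L x))"
        unfolding simplex_bd_def sum.reindex[OF inj] o_def
      proof (intro sum.cong refl)
        fix x assume "x \<in> V - L"
        then have "insert x L - L = {x}"
          by auto
        then show "face_sign L x * a (insert x L) = a (insert x L) * (\<Sum>x\<in>insert x L - L. face_sign L x)"
          by simp
      qed
      also have "\<dots> = (\<Sum>J\<in>{J \<in> B (Suc i). L \<subseteq> J}. a J * (\<Sum>x\<in>J - L. face_sign L x))"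
      proof (rule sum.mono_neutral_right)
        show "{J \<in> B (Suc i). L \<subseteq> J} \<subseteq> ?S"
        proof safe
          fix J assume J: "J \<in> B (Suc i)" "L \<subseteq> J"
          then have "card (J - L) = 1" "J \<subseteq> V"
            using L finJ by (auto simp: B_def card_Diff_subset)
          then obtain x where "J - L = {x}"
            using card_1_singletonE by blast
          then show "J \<in> ?S"
            using J(2) \<open>J \<subseteq> V\<close> by (intro image_eqI[of _ _ x]) auto
        qed
        show "\<forall>J\<in>?S - {J \<in> B (Suc i). L \<subseteq> J}. a J * (\<Sum>x\<in>J - L. face_sign L x) = 0"
          using a by (auto simp: vecs_def)
      qed (use V in simp)
      also have "\<dots> = mat_apply (B (Suc i)) (c i) a L"
        unfolding mat_apply_def using True finB
        by (simp add: c_def sum.inter_filter if_distrib cong: if_cong)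
      finally show ?thesis
        by simp
    qed
  qed
  have bd_chain: "simplex_bd V a \<in> chains (B i) (\<sigma> i) m"
    if a: "a \<in> chains (B (Suc i)) (\<sigma> (Suc i)) m" for a :: "nat set \<Rightarrow> 'k" and i m
  proof -
    have "L \<in> B i \<and> mon_lcm (u ` L) \<preceq> m" if "simplex_bd V a L \<noteq> 0" for L
    proof -
      have "\<exists>x\<in>V - L. a (insert x L) \<noteq> 0"
      proof (rule ccontr)
        assume "\<not> ?thesis"
        then have "simplex_bd V a L = 0"
          by (simp add: simplex_bd_def)
        with that show False
          by simp
      qed
      then obtain x where x: "x \<in> V - L" "a (insert x L) \<noteq> 0"
        by blast
      then have J: "insert x L \<in> B (Suc i)" "mon_lcm (u ` insert x L) \<preceq> m"
        using a by (auto simp: chains_def vecs_def \<sigma>_def)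
      then have ins: "insert x L \<in> \<Delta>" "card (insert x L) = Suc i"
        by (simp_all add: B_def)
      have L: "L \<in> \<Delta>"
        using down[OF ins(1)] by blast
      then have "card L = i"
        using ins(2) x(1) finJ(1)[OF L] by simp
      moreover have "mon_lcm (u ` L) \<preceq> m"
        using J(2) lcm_dvd[OF L, of m] lcm_dvd[OF ins(1), of m] by blast
      ultimately show ?thesis
        using L by (simp add: B_def)
    qed
    then show ?thesis
      by (auto simp: chains_def vecs_def \<sigma>_def)
  qed
  have exact: "mat_apply (B (Suc i)) (c i) ` chains (B (Suc i)) (\<sigma> (Suc i)) m =
      strand_cycles (u ` V) B \<sigma> c i m" for i m
  proof (intro equalityI subsetI)
    fix b assume "b \<in> mat_apply (B (Suc i)) (c i) ` chains (B (Suc i)) (\<sigma> (Suc i)) m"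
    then obtain a where a: "a \<in> chains (B (Suc i)) (\<sigma> (Suc i)) m" "b = simplex_bd V a"
      using mat_apply_c by (auto simp: chains_def)
    show "b \<in> strand_cycles (u ` V) B \<sigma> c i m"
    proof (cases i)
      case 0
      have "\<exists>j\<in>V. u j \<preceq> m" if "b \<noteq> 0"
      proof -
        have "a \<noteq> 0"
        proof
          assume "a = 0"
          then have "simplex_bd V a = 0"
            by (simp add: simplex_bd_def fun_eq_iff)
          with that a(2) show False
            by simp
        qed
        then obtain J where "a J \<noteq> 0"
          by (auto simp: fun_eq_iff)
        then have J: "J \<in> \<Delta>" "card J = 1" "mon_lcm (u ` J) \<preceq> m"
          using a(1) 0 by (auto simp: chains_def vecs_def B_def \<sigma>_def)
        then obtain j where "J = {j}"
          using card_1_singletonE by blast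
        then show ?thesis
          using J(3) lcm_dvd[OF J(1), of m] finJ(2)[OF J(1)] by blast
      qed
      then show ?thesis
        using 0 bd_chain[OF a(1)] a(2) by auto
    next
      case (Suc n)
      have "simplex_bd V (simplex_bd V a) L = 0" for L
      proof (cases "finite L")
        case False
        have "simplex_bd V a (insert x L) = 0" for x
          using bd_chain[OF a(1)] False finJ(1)[of "insert x L"] by (auto simp: chains_def vecs_def B_def)
        then show ?thesis
          by (simp add: simplex_bd_def[of V "simplex_bd V a"])
      qed (use simplex_bd_bd V in blast)
      then have "simplex_bd V b = 0"
        by (intro ext) (simp add: a(2))
      moreover have "mat_apply (B (Suc n)) (c n) b = simplex_bd V b"
        using mat_apply_c bd_chain[OF a(1)] Suc a(2) by (simp add: chains_def)
      ultimately show ?thesis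
        using Suc bd_chain[OF a(1)] a(2) by simp
    qed
  next
    fix a assume a: "a \<in> strand_cycles (u ` V) B \<sigma> c i m"
    then have a': "a \<in> chains (B i) (\<sigma> i) m"
      by (cases i) auto
    have vanish: "a L = 0" if "infinite L" for L
      using a' that finJ by (auto simp: chains_def vecs_def B_def)
    show "a \<in> mat_apply (B (Suc i)) (c i) ` chains (B (Suc i)) (\<sigma> (Suc i)) m"
    proof (cases "\<exists>j\<in>V. u j \<preceq> m")
      case False
      have "a L = 0" for L
      proof (rule ccontr)
        assume nz: "a L \<noteq> 0"
        then have "i \<noteq> 0"
          using a False by (cases i) auto
        moreover have L: "L \<in> \<Delta>" "card L = i" "mon_lcm (u ` L) \<preceq> m"
          using a' nz by (auto simp: chains_def vecs_def B_def \<sigma>_def)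
        ultimately obtain j where "j \<in> L"
          by fastforce
        then show False
          using L lcm_dvd finJ False by blast
      qed
      then have "a = mat_apply (B (Suc i)) (c i) 0"
        by (simp add: fun_eq_iff)
      moreover have "0 \<in> chains (B (Suc i)) (\<sigma> (Suc i)) m"
        by (simp add: chains_def)
      ultimately show ?thesis
        by blast
    next
      case True
      then obtain v where v: "v \<in> V" "u v \<preceq> m"
        "\<And>J. J \<in> \<Delta> \<Longrightarrow> mon_lcm (u ` J) \<preceq> m \<Longrightarrow> insert v J \<in> \<Delta>"
        using apex by blast
      have "simplex_bd V a = 0"
      proof (cases i)
        case 0
        then have "a (insert x L) = 0" for x L
          using a' B_0 by (auto simp: chains_def vecs_def)
        then show ?thesis
          by (simp add: simplex_bd_def fun_eq_iff)
      next
        case (Suc n)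
        then show ?thesis
          using a mat_apply_c[of a n] by (simp add: chains_def)
      qed
      have "simplex_bd V (cone v a) L = a L" for L
      proof (cases "finite L")
        case True
        then show ?thesis
          using simplex_bd_cone V(1) v(1) \<open>simplex_bd V a = 0\<close> by blast
      next
        case False
        have "cone v a J = 0" if "infinite J" for J
          using that vanish[of "J - {v}"] by (simp add: cone_def)
        with False show ?thesis
          by (simp add: vanish simplex_bd_def)
      qed
      moreover have chain: "cone v a \<in> chains (B (Suc i)) (\<sigma> (Suc i)) m"
      proof -
        have "J \<in> B (Suc i) \<and> mon_lcm (u ` J) \<preceq> m" if "cone v a J \<noteq> 0" for J
        proof -
          have J: "v \<in> J" "a (J - {v}) \<noteq> 0"
            using that by (auto simp: cone_def split: if_splits)
          then have "J - {v} \<in> B i" "mon_lcm (u ` (J - {v})) \<preceq> m"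
            using a' unfolding chains_def vecs_def \<sigma>_def by blast+
          then have K: "J - {v} \<in> \<Delta>" "card (J - {v}) = i" "mon_lcm (u ` (J - {v})) \<preceq> m"
            unfolding B_def by blast+
          have "J \<in> \<Delta>"
            using v(3)[OF K(1,3)] J(1) by (simp add: insert_absorb)
          moreover have "card J = Suc i"
            using K(2) J(1) finJ[OF calculation] by (metis card_Suc_Diff1)
          moreover have "mon_lcm (u ` J) \<preceq> m"
            using K(1,3) lcm_dvd[OF K(1)] lcm_dvd[OF \<open>J \<in> \<Delta>\<close>] v(2) by auto
          ultimately show ?thesis
            by (simp add: B_def)
        qed
        then show ?thesis
          by (auto simp: chains_def vecs_def \<sigma>_def)
      qed
      ultimately have "a = mat_apply (B (Suc i)) (c i) (cone v a)"
        using mat_apply_c[of "cone v a" i] by (simp add: fun_eq_iff chains_def)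
      then show ?thesis
        using chain by blast
    qed
  qed
  interpret multigraded_resolution "u ` V" B \<sigma> c e
  proof
    fix i b m
    show "bij_betw (e i) {..<card (B i)} (B i)"
      by (rule e)
    show "card (B 0) = 1"
      by (simp add: B_0)
    show "b \<in> B 0 \<Longrightarrow> \<sigma> 0 b = 0"
      by (auto simp: B_0 \<sigma>_def intro!: poly_mapping_eqI simp: lookup_mon_lcm)
    show "c i b \<in> chains (B i) (\<sigma> i) (\<sigma> (Suc i) b)" if b: "b \<in> B (Suc i)"
    proof -
      have "\<sigma> i L \<preceq> \<sigma> (Suc i) b" if "L \<in> B i" "L \<subseteq> b" for L
        using that b finJ[of b] finJ[of L] unfolding \<sigma>_def B_def
        by (auto simp: mon_lcm_dvd_iff intro!: mon_dvd_lcm)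
      then show ?thesis
        by (auto simp: chains_def vecs_def c_def)
    qed
    show "mat_apply (B (Suc i)) (c i) ` chains (B (Suc i)) (\<sigma> (Suc i)) m = strand_cycles (u ` V) B \<sigma> c i m"
      by (rule exact)
  qed
  show ?thesis
    by (rule that[OF graded_free_resolution_F]) (simp add: shifts_F \<sigma>_def B_def)
qed

section \<open>Supports and covers of squarefree generators\<close>

text \<open>
  A minimal monomial generator is divisible by one of the given squarefree generators, which in turn
  is divisible by a minimal generator; by minimality all three coincide.
\<close>

lemma minimal_generators_squarefree:
  fixes I :: "('x::finite, 'k::field) mpoly set"
  assumes "squarefree_monomial_ideal I" "minimal_monomial_generators G I" "g \<in> G"
  shows "squarefree_mon g"
proof -
  obtain U where U: "\<And>m. m \<in> U \<Longrightarrow> squarefree_mon m" "I = ideal_gen (monom_poly ` U)"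
    using assms(1) unfolding squarefree_monomial_ideal_def by blast
  have G: "I = ideal_gen (monom_poly ` G)" "\<And>G'. G' \<subset> G \<Longrightarrow> ideal_gen (monom_poly ` G') \<noteq> I"
    using assms(2) by (auto simp: minimal_monomial_generators_def)
  have mem: "(monom_poly m :: ('x, 'k) mpoly) \<in> ideal_gen (monom_poly ` A) \<longleftrightarrow> (\<exists>a\<in>A. a \<preceq> m)" for m A
    by (auto simp: monomial_ideal_iff lookup_single when_def)
  have in_G: "(monom_poly m :: ('x, 'k) mpoly) \<in> I \<longleftrightarrow> (\<exists>a\<in>G. a \<preceq> m)" for m
    unfolding G(1) by (rule mem)
  have in_U: "(monom_poly m :: ('x, 'k) mpoly) \<in> I \<longleftrightarrow> (\<exists>a\<in>U. a \<preceq> m)" for m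
    unfolding U(2) by (rule mem)
  obtain v where v: "v \<in> U" "v \<preceq> g"
    using in_G in_U assms(3) mon_dvd_refl by blast
  obtain h where h: "h \<in> G" "h \<preceq> v"
    using in_G in_U v(1) mon_dvd_refl by blast
  have "h = g"
  proof (rule ccontr)
    assume "h \<noteq> g"
    have "(\<exists>a\<in>G - {g}. a \<preceq> m) \<longleftrightarrow> (\<exists>a\<in>G. a \<preceq> m)" for m
      using \<open>h \<noteq> g\<close> h v(2) mon_dvd_trans by blast
    then have "ideal_gen (monom_poly ` (G - {g})) = I"
      unfolding G(1) set_eq_iff monomial_ideal_iff by simp
    then show False
      using G(2)[of "G - {g}"] assms(3) by blast
  qed
  then show ?thesis
    using U(1) v h(2) mon_dvd_antisym by blast
qed

lemma squarefree_mon_eq_iff: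
  "squarefree_mon s \<Longrightarrow> squarefree_mon t \<Longrightarrow> s = t \<longleftrightarrow> supp s = supp t"
  by (metis mon_dvd_antisym order_refl squarefree_mon_dvd_iff)

lemma mon_deg_squarefree:
  assumes "squarefree_mon s"
  shows "mon_deg s = card (supp s)"
proof -
  have "Poly_Mapping.lookup s x = (if x \<in> supp s then 1 else 0)" for x
  proof (cases "x \<in> supp s")
    case True
    then have "Poly_Mapping.lookup s x \<noteq> 0" "Poly_Mapping.lookup s x \<le> 1"
      using assms by (auto simp: squarefree_mon_def in_keys_iff)
    then show ?thesis
      using True by simp
  qed (simp add: in_keys_iff)
  then have "mon_deg s = (\<Sum>x\<in>UNIV. if x \<in> supp s then 1 else 0)"
    unfolding mon_deg_def by (intro sum.cong) auto
  then show ?thesis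
    by (simp add: sum.If_cases)
qed

lemma supp_mon_lcm:
  assumes "finite U"
  shows "supp (mon_lcm U) = (\<Union>g\<in>U. supp g)"
proof -
  have "Poly_Mapping.lookup (mon_lcm U) x = 0 \<longleftrightarrow> (\<forall>g\<in>U. Poly_Mapping.lookup g x = 0)" for x
  proof -
    have "Poly_Mapping.lookup (mon_lcm U) x = 0 \<longleftrightarrow> Poly_Mapping.lookup (mon_lcm U) x \<le> 0"
      by simp
    also have "\<dots> \<longleftrightarrow> (\<forall>g\<in>U. Poly_Mapping.lookup g x = 0)"
      using assms unfolding lookup_mon_lcm by (subst Max_le_iff) auto
    finally show ?thesis .
  qed
  then show ?thesis
    by (auto simp: in_keys_iff)
qed

lemma squarefree_mon_lcm:
  assumes "finite U" "\<And>g. g \<in> U \<Longrightarrow> squarefree_mon g"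
  shows "squarefree_mon (mon_lcm U)"
  using assms by (auto simp: squarefree_mon_def lookup_mon_lcm)

text \<open>
  The set \<open>J\<close> becomes a cover when one adds, for each variable that it misses, an index of a
  generator that contains this variable.
\<close>

lemma min_cover_number_le:
  fixes u :: "nat \<Rightarrow> 'x::finite mon"
  assumes u: "\<And>j. j \<in> {1..p} \<Longrightarrow> squarefree_mon (u j)" and J: "J \<subseteq> {1..p}" "J \<noteq> {}"
  shows "min_cover_number u p + mon_deg (mon_lcm (u ` J)) \<le> card J + mon_deg (mon_lcm (u ` {1..p}))"
proof -
  have finJ: "finite J"
    using J(1) finite_subset by blast
  have sqf: "squarefree_mon (mon_lcm (u ` K))" if "K \<subseteq> {1..p}" for K
    using u that finite_subset[OF that] by (intro squarefree_mon_lcm) auto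
  have supp_lcm: "supp (mon_lcm (u ` K)) = (\<Union>j\<in>K. supp (u j))" if "K \<subseteq> {1..p}" for K
    using finite_subset[OF that] by (simp add: supp_mon_lcm)
  define D where "D = (\<Union>j\<in>{1..p}. supp (u j)) - (\<Union>j\<in>J. supp (u j))"
  have "\<forall>x\<in>D. \<exists>j\<in>{1..p}. x \<in> supp (u j)"
    by (auto simp: D_def)
  then obtain f where f: "\<And>x. x \<in> D \<Longrightarrow> f x \<in> {1..p} \<and> x \<in> supp (u (f x))"
    by metis
  define K where "K = J \<union> f ` D"
  have K: "K \<subseteq> {1..p}" "finite K"
    using J(1) f finite_subset[of D UNIV] finJ by (auto simp: K_def)
  have "(\<Union>j\<in>K. supp (u j)) = (\<Union>j\<in>{1..p}. supp (u j))"
  proof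
    show "(\<Union>j\<in>{1..p}. supp (u j)) \<subseteq> (\<Union>j\<in>K. supp (u j))"
      using f unfolding K_def D_def by blast
  qed (use K in blast)
  then have "mon_lcm (u ` K) = mon_lcm (u ` {1..p})"
    using K(1) by (simp add: squarefree_mon_eq_iff sqf supp_lcm)
  moreover have "1 \<le> card K"
    using K(2) J(2) by (auto simp: K_def Suc_le_eq card_gt_0_iff)
  ultimately have "min_cover_number u p \<le> card K"
    unfolding min_cover_number_def using K(1) by (intro Least_le) blast
  also have "\<dots> \<le> card J + card D"
    unfolding K_def using card_Un_le[of J "f ` D"] card_image_le[of D f] by simp
  finally have "min_cover_number u p \<le> card J + card D" .
  moreover have "card D + card (\<Union>j\<in>J. supp (u j)) = card (\<Union>j\<in>{1..p}. supp (u j))"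
  proof -
    have "(\<Union>j\<in>J. supp (u j)) \<subseteq> (\<Union>j\<in>{1..p}. supp (u j))"
      using J(1) by blast
    then show ?thesis
      unfolding D_def by (simp add: card_Diff_subset card_mono)
  qed
  ultimately show ?thesis
    using J(1) by (simp add: mon_deg_squarefree sqf supp_lcm)
qed

section \<open>Projective dimension and regularity\<close>

theorem theorem3p3:
  fixes I :: "('x::finite, 'k::field) mpoly set"
    and u :: "nat \<Rightarrow> 'x mon"
    and p :: nat
  assumes "squarefree_monomial_ideal I"
    and "p \<ge> 1"
    and "inj_on u {1..p}"
    and "minimal_monomial_generators (u ` {1..p}) I"
  shows "pd I \<le> min (support_index u p) CARD('x) \<and>
         int (min (support_index u p) CARD('x)) = min (int (b_cosize u p) - 1) (int CARD('x)) \<and>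
         reg I \<le> cosize u p + 1"
proof -
  define V where "V = {1..p}"
  define s where "s = support_index u p"
  define covers where "covers J \<longleftrightarrow> mon_lcm (u ` J) = mon_lcm (u ` V)" for J
  have I: "I = ideal_gen (monom_poly ` u ` V)"
    using assms(4) by (simp add: minimal_monomial_generators_def V_def)
  have u: "squarefree_mon (u j)" if "j \<in> V" for j
    using minimal_generators_squarefree[OF assms(1,4)] that by (simp add: V_def)
  have finJ: "finite J" if "J \<subseteq> V" for J
    using that finite_subset[of J V] by (simp add: V_def)
  have sqf: "squarefree_mon (mon_lcm (u ` J))" if "J \<subseteq> V" for J
    using u that finJ[OF that] by (intro squarefree_mon_lcm) auto
  have supp_lcm: "supp (mon_lcm (u ` J)) = (\<Union>j\<in>J. supp (u j))" if "J \<subseteq> V" for J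
    using finJ[OF that] by (simp add: supp_mon_lcm)
  have covers_iff: "covers J \<longleftrightarrow> (\<Union>j\<in>J. supp (u j)) = (\<Union>j\<in>V. supp (u j))" if "J \<subseteq> V" for J
    using that by (simp add: covers_def squarefree_mon_eq_iff sqf supp_lcm)
  have s_alt: "s = (LEAST i. i < p \<and> (\<forall>J. J \<subseteq> V \<and> card J = i + 1 \<longrightarrow> covers J))"
  proof -
    have "(\<forall>A\<in>supp_unions u p i. A = (\<Union>j\<in>{1..p}. supp (u j))) \<longleftrightarrow>
        (\<forall>J. J \<subseteq> V \<and> card J = i + 1 \<longrightarrow> (\<Union>j\<in>J. supp (u j)) = (\<Union>j\<in>V. supp (u j)))" for i
    proof -
      have "(\<forall>A\<in>{f J | J. P J}. A = c) \<longleftrightarrow> (\<forall>J. P J \<longrightarrow> f J = c)"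
        for f :: "nat set \<Rightarrow> 'x set" and P c
        by blast
      then show ?thesis
        unfolding supp_unions_def V_def .
    qed
    moreover have "(\<forall>J. J \<subseteq> V \<and> card J = i + 1 \<longrightarrow>
        (\<Union>j\<in>J. supp (u j)) = (\<Union>j\<in>V. supp (u j))) \<longleftrightarrow> (\<forall>J. J \<subseteq> V \<and> card J = i + 1 \<longrightarrow> covers J)" for i
      using covers_iff by (metis (no_types, lifting))
    ultimately have "(\<forall>A\<in>supp_unions u p i. A = (\<Union>j\<in>{1..p}. supp (u j))) \<longleftrightarrow>
        (\<forall>J. J \<subseteq> V \<and> card J = i + 1 \<longrightarrow> covers J)" for i
      by simp
    then show ?thesis
      by (simp add: s_def support_index_def)
  qed
  have "J = V" if "J \<subseteq> V" "card J = p" for J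
    using that by (intro card_subset_eq) (simp_all add: V_def)
  then have "p - 1 < p \<and> (\<forall>J. J \<subseteq> V \<and> card J = p - 1 + 1 \<longrightarrow> covers J)"
    using assms(2) by (auto simp: covers_def)
  from LeastI[of "\<lambda>i. i < p \<and> (\<forall>J. J \<subseteq> V \<and> card J = i + 1 \<longrightarrow> covers J)", OF this]
  have s: "s < p" "\<And>J. J \<subseteq> V \<Longrightarrow> card J = Suc s \<Longrightarrow> covers J"
    unfolding s_alt[symmetric] by auto
  have b_cosize: "b_cosize u p = Suc s"
    unfolding b_cosize_def
  proof (rule Least_equality)
    show "1 \<le> Suc s \<and> (\<forall>J. J \<subseteq> {1..p} \<and> card J = Suc s \<longrightarrow> mon_lcm (u ` J) = mon_lcm (u ` {1..p}))"
      using s(2) by (simp add: covers_def V_def)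
  next
    fix l
    assume l: "1 \<le> l \<and> (\<forall>J. J \<subseteq> {1..p} \<and> card J = l \<longrightarrow> mon_lcm (u ` J) = mon_lcm (u ` {1..p}))"
    then obtain i where i: "l = Suc i"
      by (cases l) auto
    \<comment> \<open>For \<open>l > p\<close> the covering condition is void, but then \<open>l\<close> exceeds \<open>s + 1 \<le> p\<close>.\<close>
    have "s \<le> i" if "i < p"
      unfolding s_alt using that l i by (intro Least_le) (simp add: covers_def V_def)
    then show "Suc s \<le> l"
      using s(1) i by (cases "i < p") auto
  qed
  \<comment> \<open>Any vertex can take the place of \<open>1\<close>. Keeping the faces with \<open>s + 1\<close> vertices through one vertex
    makes that vertex an apex, whereas without any of them the boundary of a simplex with
    \<open>s + 1\<close> vertices would not be filled.\<close>
  define \<Delta> where "\<Delta> = {J. J \<subseteq> V \<and> (card J \<le> s \<or> card J = Suc s \<and> 1 \<in> J)}"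
  have one: "1 \<in> V"
    using assms(2) by (simp add: V_def)
  obtain G :: "('x, 'k) free_complex" where G: "graded_free_resolution I G"
    "\<And>i. set (shifts G i) = (\<lambda>J. int (mon_deg (mon_lcm (u ` J)))) ` {J \<in> \<Delta>. card J = Suc i}"
  proof (rule supported_resolution_exists[of V \<Delta> u])
    show "finite V" "\<Delta> \<subseteq> Pow V" "{} \<in> \<Delta>"
      by (auto simp: V_def \<Delta>_def)
  next
    fix J L assume J: "J \<in> \<Delta>" and L: "L \<subseteq> J"
    have "finite J"
      using J finJ by (auto simp: \<Delta>_def)
    then have "L = J \<or> card L < card J"
      using L psubset_card_mono by blast
    then show "L \<in> \<Delta>"
      using J L by (auto simp: \<Delta>_def)
  next
    fix m j assume j: "j \<in> V" "u j \<preceq> m"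
    show "\<exists>v\<in>V. u v \<preceq> m \<and> (\<forall>J\<in>\<Delta>. mon_lcm (u ` J) \<preceq> m \<longrightarrow> insert v J \<in> \<Delta>)"
    proof (cases "u 1 \<preceq> m")
      case True
      have "insert 1 J \<in> \<Delta>" if "J \<in> \<Delta>" for J
        using that one finJ[of J] by (cases "1 \<in> J") (auto simp: \<Delta>_def insert_absorb)
      then show ?thesis
        using True one by blast
    next
      case False
      have "insert j J \<in> \<Delta>" if J: "J \<in> \<Delta>" "mon_lcm (u ` J) \<preceq> m" for J
      proof -
        have sub: "insert j J \<subseteq> V"
          using J(1) j(1) by (auto simp: \<Delta>_def)
        have "card (insert j J) \<le> s"
        proof (rule ccontr)
          assume "\<not> card (insert j J) \<le> s"
          then obtain K where K: "K \<subseteq> insert j J" "card K = Suc s"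
            using obtain_subset_with_card_n[of "Suc s" "insert j J"] by (metis not_less_eq_eq)
          then have "mon_lcm (u ` K) = mon_lcm (u ` V)"
            using s(2)[of K] sub by (auto simp: covers_def)
          then have "u 1 \<preceq> mon_lcm (u ` K)"
            using mon_dvd_lcm[of "u ` V" "u 1"] one finJ[of V] by simp
          also have "u i \<preceq> m" if "i \<in> K" for i
            using that K(1) j(2) J mon_lcm_dvd_iff[of "u ` J" m] finJ[of J] by (auto simp: \<Delta>_def)
          then have "mon_lcm (u ` K) \<preceq> m"
            using finJ[of K] K(1) sub by (subst mon_lcm_dvd_iff) auto
          finally (mon_dvd_trans) show False
            using False by simp
        qed
        then show ?thesis
          using sub by (simp add: \<Delta>_def)
      qed
      then show ?thesis
        using j by blast
    qed
  qed (use I in auto)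
  define F :: "('x, 'k) free_complex" where "F = (SOME F. minimal_graded_free_resolution I F)"
  have "\<exists>F :: ('x, 'k) free_complex. minimal_graded_free_resolution I F"
    unfolding I by (rule minimal_resolution_exists[of "u ` V"]) (use u in blast)+
  then have F: "minimal_graded_free_resolution I F"
    unfolding F_def by (rule someI_ex)
  have betti: "graded_betti I i j \<noteq> 0 \<longleftrightarrow> j \<in> set (shifts F i)" for i j
    by (simp add: graded_betti_def F_def count_list_0_iff)
  have face: "\<exists>J. J \<subseteq> V \<and> card J = Suc i \<and> i \<le> s \<and> j = int (mon_deg (mon_lcm (u ` J)))"
    if "j \<in> set (shifts F i)" for i j
  proof -
    have "j \<in> set (shifts G i)"
      using minimal_shifts_subset[OF F G(1)] that by blast
    then obtain J where "J \<in> {J \<in> \<Delta>. card J = Suc i}" "j = int (mon_deg (mon_lcm (u ` J)))"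
      unfolding G(2) by (rule imageE)
    then show ?thesis
      by (intro exI[of _ J]) (auto simp: \<Delta>_def)
  qed
  have lower: "int i \<le> j" if "j \<in> set (shifts F i)" for i j
    by (rule minimal_shift_ge[OF F _ that]) (use face in fastforce)
  have bounds: "i \<le> s \<and> i \<le> CARD('x) \<and> j - int i \<le> cosize u p + 1" if j: "j \<in> set (shifts F i)" for i j
  proof -
    obtain J where J: "J \<subseteq> V" "card J = Suc i" "i \<le> s" "j = int (mon_deg (mon_lcm (u ` J)))"
      using face[OF j] by blast
    have "mon_deg (mon_lcm (u ` J)) \<le> CARD('x)"
      using sqf[OF J(1)] by (simp add: mon_deg_squarefree card_mono)
    moreover have "J \<noteq> {}"
      using J(2) by auto
    then have "min_cover_number u p + mon_deg (mon_lcm (u ` J)) \<le> Suc i + mon_deg (mon_lcm (u ` {1..p}))"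
      using min_cover_number_le[of p u J] u J(1,2) by (simp add: V_def)
    ultimately show ?thesis
      using lower[OF j] J(3,4) by (simp add: cosize_def)
  qed
  have nonempty: "set (shifts F 0) \<noteq> {}"
  proof
    assume "set (shifts F 0) = {}"
    then have "I \<subseteq> {0}"
      using F by (auto simp: minimal_graded_free_resolution_def graded_free_resolution_def
          aug_map_def rank_def)
    moreover have "(monom_poly (u 1) :: ('x, 'k) mpoly) \<in> I"
      unfolding I using one
    by (auto simp: monomial_ideal_iff lookup_single when_def intro!: bexI[of _ 1])
    ultimately have "(monom_poly (u 1) :: ('x, 'k) mpoly) = 0"
      by blast
    then show False
      by (metis lookup_single_eq lookup_zero zero_neq_one)
  qed
  obtain j0 where j0: "j0 \<in> set (shifts F 0)"
    using nonempty unfolding ex_in_conv[symmetric] ..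
  have ne: "A \<noteq> {}" if "a \<in> A" for A :: "'b set" and a
    using that by blast
  have "pd I \<le> min s CARD('x)"
    unfolding pd_def betti
  proof (rule Max.boundedI)
    have "{i. \<exists>j. j \<in> set (shifts F i)} \<subseteq> {..s}"
    proof clarify
      fix i j assume j: "j \<in> set (shifts F i)"
      show "i \<le> s"
        using bounds[OF j] by simp
    qed
    then show "finite {i. \<exists>j. j \<in> set (shifts F i)}"
      by (rule finite_subset) simp
    have "0 \<in> {i. \<exists>j. j \<in> set (shifts F i)}"
      using j0 by (intro CollectI exI)
    then show "{i. \<exists>j. j \<in> set (shifts F i)} \<noteq> {}"
      by (rule ne)
    show "i \<le> min s CARD('x)" if "i \<in> {i. \<exists>j. j \<in> set (shifts F i)}" for i
      using that
    proof clarify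
      fix j assume j: "j \<in> set (shifts F i)"
      show "i \<le> min s CARD('x)"
        using bounds[OF j] by simp
    qed
  qed
  moreover have "reg I \<le> cosize u p + 1"
    unfolding reg_def betti
  proof (rule Max.boundedI)
    have "{j - int i |i j. j \<in> set (shifts F i)} \<subseteq> (\<Union>i\<le>s. (\<lambda>j. j - int i) ` set (shifts F i))"
    proof clarify
      fix i j assume j: "j \<in> set (shifts F i)"
      then show "j - int i \<in> (\<Union>i\<le>s. (\<lambda>j. j - int i) ` set (shifts F i))"
        using bounds[OF j] by blast
    qed
    then show "finite {j - int i |i j. j \<in> set (shifts F i)}"
      by (rule finite_subset) simp
    have "j0 - int 0 \<in> {j - int i |i j. j \<in> set (shifts F i)}"
      using j0 by blast
    then show "{j - int i |i j. j \<in> set (shifts F i)} \<noteq> {}"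
      by (rule ne)
    show "d \<le> cosize u p + 1" if "d \<in> {j - int i |i j. j \<in> set (shifts F i)}" for d
      using that
    proof clarify
      fix i j assume j: "j \<in> set (shifts F i)"
      show "j - int i \<le> cosize u p + 1"
        using bounds[OF j] by simp
    qed
  qed
  moreover have "int (min s CARD('x)) = min (int (b_cosize u p) - 1) (int CARD('x))"
    by (simp add: b_cosize)
  ultimately show ?thesis
    by (simp add: s_def)
qed

end
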